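(* Fix $0\le\gamma<\alpha_-$ and set $$\theta_\gamma:=\frac{\alpha_+}{2\alpha_+-\gamma}\in\left[\tfrac12,1\right).$$ For $p,q\in\mathcal P$ and $\alpha,\beta\in\mathcal A$ define $$D_\gamma(p,\alpha;q,\beta):=\bigl\|\partial_t^\gamma\mathcal M_{p,\alpha}-\partial_t^\gamma\mathcal M_{q,\beta}\bigr\|_{L^\infty(0,T)}.$$ There exist constants $D_*>0$ and $C>0$ such that, for all $p,q\in\mathcal P$ and $\alpha,\beta\in\mathcal A$, writing $D_\gamma:=D_\gamma(p,\alpha;q,\beta)$: if $0<D_\gamma\le D_*$, then $$|\alpha-\beta|\le C\,\frac{D_\gamma^{\theta_\gamma}}{1+|\log D_\gamma|}.$$ If $D_\gamma=0$, then $\alpha=\beta$.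
   Context: Let $T>0$ and let $X$ be a separable Hilbert space with inner product $(\cdot,\cdot)_X$ (linear in the first argument) and norm $\|\cdot\|_X$. For $\alpha\in(0,1)$ the fractional Riemann--Liouville integral (Bochner integral) is $J^\alpha w(t):=\frac1{\Gamma(\alpha)}\int_0^t(t-s)^{\alpha-1}w(s)\,ds$, $0<t<T$. It is an injective operator on $L^2(0,T;X)$, and likewise on scalar-valued $L^2(0,T)$. Set $\partial_t^\alpha:=(J^\alpha)^{-1}$ with domain $H_\alpha(0,T;X):=J^\alpha L^2(0,T;X)$, and similarly for scalar-valued functions; $\partial_t^0$ and $J^0$ are the identity. Operator: $A:\mathcal D(A)\subset X\to X$ is densely defined, self-adjoint and negative, $-A\ge\lambda_1I$ for some $\lambda_1>0$, and $A$ has compact resolvent. Thus $-A=\sum_{n=1}^\infty\lambda_nP_n$ with $0<\lambda_1<\lambda_2<\cdots$ the distinct eigenvalues and $P_n$ the mutually orthogonal spectral projections. For $a,b>0$, $E_{a,b}(z):=\sum_{k=0}^\infty \frac{z^k}{\Gamma(ak+b)}$ is the two-parameter Mittag--Leffler function. Fix constants $0<\alpha_-<\alpha_+<1$, $p_0\ne0$, $M>|p_0|$, and put $\mathcal A:=[\alpha_-,\alpha_+]$, $\mathcal P:=\{p\in C^1[0,T]: p(0)=p_0,\ \|p\|_{C^1[0,T]}\le M\}$ (scalar-valued functions). Fix $f\in X$ and $\psi\in\mathcal D(A)$ with $c_*:=p_0(f,\psi)_X\ne0$. For $p\in\mathcal P$, $\alpha\in\mathcal A$, $u_{p,\alpha}\in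 H_\alpha(0,T;X)$ denotes the solution of $\partial_t^\alpha u(t)=Au(t)+p(t)f$, $t\in(0,T)$, given by $$u_{p,\alpha}(t)=\sum_{n=1}^\infty\int_0^t(t-s)^{\alpha-1}E_{\alpha,\alpha}\bigl(-\lambda_n(t-s)^\alpha\bigr)p(s)P_nf\,ds,$$ with the series convergent in $H_\alpha(0,T;X)\cap L^2(0,T;\mathcal D(A))$. The scalar observation is $\mathcal M_{p,\alpha}(t):=(u_{p,\alpha}(t),\psi)_X$, $0<t<T$. For $0\le\gamma<\alpha_-$ the functions $\partial_t^\gamma\mathcal M_{p,\alpha}$ are bounded on $(0,T)$. *)

theory Defs
  imports "HOL-Analysis.Analysis" "HOL-Probability.Essential_Supremum"
begin

text \<open>
  The scalar field is any type of sort \<open>{real_normed_field, euclidean_space}\<close>. A commutative real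
  division algebra of finite dimension is isomorphic to the reals or to the complex numbers, so
  these two fields are exactly the instances up to isomorphism, and real and complex Hilbert spaces
  are covered at once. On both, \<open>x \<bullet> 1\<close> is the real part.
\<close>

definition scalar_cnj :: "'k::{real_normed_field,euclidean_space} \<Rightarrow> 'k" where
  "scalar_cnj x = of_real (2 * (x \<bullet> 1)) - x"

lemma scalar_cnj_real: "scalar_cnj (x::real) = x"
  by (simp add: scalar_cnj_def)

lemma scalar_cnj_complex: "scalar_cnj (z::complex) = cnj z"
  by (simp add: scalar_cnj_def complex_eq_iff inner_complex_def)

text \<open>
  A separable Hilbert space over the scalars \<open>'k\<close>: the type class of \<open>'x\<close> supplies the underlying
  real Hilbert space (the norm, completeness, separability as second countability), whose inner
  product is the real part of the scalar-valued one. In particular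
  \<open>norm x = sqrt (ip x x \<bullet> 1)\<close>, and positive definiteness of \<open>ip\<close> is inherited.
\<close>

locale separable_hilbert_over = vector_space scl
  for scl :: "'k::{real_normed_field,euclidean_space} \<Rightarrow>
      'x::{real_inner,banach,second_countable_topology} \<Rightarrow> 'x" +
  fixes ip :: "'x \<Rightarrow> 'x \<Rightarrow> 'k"
  assumes scl_of_real: "scl (of_real r) x = r *\<^sub>R x"
    and ip_add_left: "ip (x + y) z = ip x z + ip y z"
    and ip_scl_left: "ip (scl c x) z = c * ip x z"
    and ip_cnj: "ip y x = scalar_cnj (ip x y)"
    and ip_real_part: "ip x y \<bullet> 1 = x \<bullet> y"

lemma separable_hilbert_over_real:
  "separable_hilbert_over scaleR
     (inner :: 'x::{real_inner,banach,second_countable_topology} \<Rightarrow> 'x \<Rightarrow> real)"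
  by unfold_locales
    (simp_all add: scalar_cnj_real inner_commute algebra_simps inner_add_left)

lemma separable_hilbert_over_complex:
  "separable_hilbert_over (*) (\<lambda>x y :: complex. x * cnj y)"
  by unfold_locales
    (simp_all add: scalar_cnj_complex scaleR_conv_of_real inner_complex_def algebra_simps)


text \<open>Unbounded operators are given by a domain \<open>D\<close> and a map \<open>A\<close> whose values outside \<open>D\<close> are
  irrelevant.\<close>

definition linear_operator_on ::
    "('k::field \<Rightarrow> 'x::ab_group_add \<Rightarrow> 'x) \<Rightarrow> 'x set \<Rightarrow> ('x \<Rightarrow> 'x) \<Rightarrow> bool" where
  "linear_operator_on scl D A \<longleftrightarrow>
     module.subspace scl D \<and>
     (\<forall>x\<in>D. \<forall>y\<in>D. A (x + y) = A x + A y) \<and>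
     (\<forall>c. \<forall>x\<in>D. A (scl c x) = scl c (A x))"

definition operator_graph :: "'x set \<Rightarrow> ('x \<Rightarrow> 'y) \<Rightarrow> ('x \<times> 'y) set" where
  "operator_graph D A = {(x, A x) | x. x \<in> D}"

definition adjoint_graph :: "('x \<Rightarrow> 'x \<Rightarrow> 'k) \<Rightarrow> 'x set \<Rightarrow> ('x \<Rightarrow> 'x) \<Rightarrow> ('x \<times> 'x) set" where
  "adjoint_graph ip D A = {(y, z). \<forall>x\<in>D. ip (A x) y = ip x z}"

definition self_adjoint_on :: "('x \<Rightarrow> 'x \<Rightarrow> 'k) \<Rightarrow> 'x set \<Rightarrow> ('x \<Rightarrow> 'x) \<Rightarrow> bool" where
  "self_adjoint_on ip D A \<longleftrightarrow> adjoint_graph ip D A = operator_graph D A"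

definition compact_operator :: "('x::metric_space \<Rightarrow> 'y::metric_space) \<Rightarrow> bool" where
  "compact_operator S \<longleftrightarrow> (\<forall>B. bounded B \<longrightarrow> compact (closure (S ` B)))"

text \<open>Compactness of one resolvent implies that of all, and implies its boundedness.\<close>

definition compact_resolvent_on ::
    "('k \<Rightarrow> 'x::real_normed_vector \<Rightarrow> 'x) \<Rightarrow> 'x set \<Rightarrow> ('x \<Rightarrow> 'x) \<Rightarrow> bool" where
  "compact_resolvent_on scl D A \<longleftrightarrow>
     (\<exists>\<mu>. bij_betw (\<lambda>x. A x - scl \<mu> x) D UNIV \<and>
          compact_operator (inv_into D (\<lambda>x. A x - scl \<mu> x)))"

definition is_orthogonal_projection ::
    "('x \<Rightarrow> 'x \<Rightarrow> 'k::zero) \<Rightarrow> 'x::ab_group_add set \<Rightarrow> ('x \<Rightarrow> 'x) \<Rightarrow> bool" where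
  "is_orthogonal_projection ip E Q \<longleftrightarrow> (\<forall>x. Q x \<in> E \<and> (\<forall>y\<in>E. ip (x - Q x) y = 0))"

text \<open>
  The standing assumptions on \<open>A\<close>, together with the expansion \<open>- A = (\<Sum>n. lam n P n)\<close> that fixes
  the notation for its eigenvalues and spectral projections. The last assumption is the equality of
  unbounded operators, including their domains. The sequences start at index 0.
\<close>

locale spectral_operator = separable_hilbert_over scl ip
  for scl :: "'k::{real_normed_field,euclidean_space} \<Rightarrow>
      'x::{real_inner,banach,second_countable_topology} \<Rightarrow> 'x"
    and ip :: "'x \<Rightarrow> 'x \<Rightarrow> 'k" +
  fixes D :: "'x set" and A :: "'x \<Rightarrow> 'x" and lam :: "nat \<Rightarrow> real" and P :: "nat \<Rightarrow> 'x \<Rightarrow> 'x"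
  assumes linear: "linear_operator_on scl D A"
    and densely_defined: "closure D = UNIV"
    and self_adjoint: "self_adjoint_on ip D A"
    and negative: "0 < lam 0" "\<And>x. x \<in> D \<Longrightarrow> lam 0 * (norm x)\<^sup>2 \<le> ip (- A x) x \<bullet> 1"
    and compact_resolvent: "compact_resolvent_on scl D A"
    and lam_strict_mono: "strict_mono lam"
    and lam_eigenvalues: "of_real ` range lam = {\<mu>. \<exists>x\<in>D. x \<noteq> 0 \<and> - A x = scl \<mu> x}"
    and P_projection: "is_orthogonal_projection ip {x\<in>D. - A x = lam n *\<^sub>R x} (P n)"
    and expansion: "operator_graph D (\<lambda>x. - A x) = {(x, y). (\<lambda>n. lam n *\<^sub>R P n x) sums y}"


text \<open>Functions on \<open>(0,T)\<close> are total functions of which only the values on \<open>{0<..<T}\<close> matter.\<close>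

definition L2_fun :: "real \<Rightarrow> (real \<Rightarrow> 'b::{banach,second_countable_topology}) \<Rightarrow> bool" where
  "L2_fun T w \<longleftrightarrow> w \<in> borel_measurable (lebesgue_on {0<..<T}) \<and>
     integrable (lebesgue_on {0<..<T}) (\<lambda>t. (norm (w t))\<^sup>2)"

definition Linf_norm :: "real \<Rightarrow> (real \<Rightarrow> 'b::real_normed_vector) \<Rightarrow> real" where
  "Linf_norm T g = real_of_ereal (esssup (lebesgue_on {0<..<T}) (\<lambda>t. ereal (norm (g t))))"

definition rl_integral ::
    "real \<Rightarrow> (real \<Rightarrow> 'b::{banach,second_countable_topology}) \<Rightarrow> real \<Rightarrow> 'b" where
  "rl_integral \<alpha> w t =
     (if \<alpha> = 0 then w t
      else (1 / Gamma \<alpha>) *\<^sub>R (LINT s:{0<..<t}|lebesgue. ((t - s) powr (\<alpha> - 1)) *\<^sub>R w s))"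

text \<open>
  The inverse of \<open>rl_integral \<alpha>\<close> on \<open>L\<^sup>2(0,T)\<close>. Elements of \<open>L\<^sup>2\<close> are classes of functions up to
  null sets, and the fractional integral is injective on these classes, so the choice only selects
  a representative.
\<close>

definition frac_deriv ::
    "real \<Rightarrow> real \<Rightarrow> (real \<Rightarrow> 'b::{banach,second_countable_topology}) \<Rightarrow> real \<Rightarrow> 'b" where
  "frac_deriv T \<alpha> g =
     (SOME w. L2_fun T w \<and> (AE t in lebesgue_on {0<..<T}. rl_integral \<alpha> w t = g t))"

definition C1_fun :: "real \<Rightarrow> (real \<Rightarrow> 'b::real_normed_vector) \<Rightarrow> bool" where
  "C1_fun T p \<longleftrightarrow>
     (\<exists>p'. continuous_on {0..T} p' \<and>
           (\<forall>t\<in>{0..T}. (p has_vector_derivative p' t) (at t within {0..T})))"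

definition C1_norm :: "real \<Rightarrow> (real \<Rightarrow> 'b::real_normed_vector) \<Rightarrow> real" where
  "C1_norm T p = (SUP t\<in>{0..T}. norm (p t)) +
     (SUP t\<in>{0..T}. norm (vector_derivative p (at t within {0..T})))"

definition admissible_sources ::
    "real \<Rightarrow> 'b::real_normed_vector \<Rightarrow> real \<Rightarrow> (real \<Rightarrow> 'b) set" where
  "admissible_sources T p0 M = {p. C1_fun T p \<and> p 0 = p0 \<and> C1_norm T p \<le> M}"

definition mittag_leffler :: "real \<Rightarrow> real \<Rightarrow> 'a::{real_normed_field,banach} \<Rightarrow> 'a" where
  "mittag_leffler a b z = (\<Sum>k. z ^ k /\<^sub>R Gamma (a * real k + b))"

text \<open>The series converges in \<open>'x\<close> at every \<open>t\<close>; the pointwise sum is its limit in the function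
  spaces on \<open>(0,T)\<close> as well.\<close>

definition solution ::
    "('k::{real_normed_field,euclidean_space} \<Rightarrow>
       'x::{real_inner,banach,second_countable_topology} \<Rightarrow> 'x) \<Rightarrow>
     (nat \<Rightarrow> real) \<Rightarrow> (nat \<Rightarrow> 'x \<Rightarrow> 'x) \<Rightarrow> 'x \<Rightarrow> (real \<Rightarrow> 'k) \<Rightarrow> real \<Rightarrow> real \<Rightarrow> 'x" where
  "solution scl lam P f p \<alpha> t =
     (\<Sum>n. LINT s:{0<..<t}|lebesgue.
        ((t - s) powr (\<alpha> - 1) * mittag_leffler \<alpha> \<alpha> (- lam n * (t - s) powr \<alpha>))
          *\<^sub>R scl (p s) (P n f))"

definition observation where
  "observation scl ip lam P f \<psi> p \<alpha> t = ip (solution scl lam P f p \<alpha> t) \<psi>"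

definition data_distance where
  "data_distance T scl ip lam P f \<psi> \<gamma> p \<alpha> q \<beta> =
     Linf_norm T (\<lambda>t. frac_deriv T \<gamma> (observation scl ip lam P f \<psi> p \<alpha>) t
                    - frac_deriv T \<gamma> (observation scl ip lam P f \<psi> q \<beta>) t)"

end

theory Submission imports Defs begin

text \<open>
  Write \<open>g a \<tau> = \<tau> powr (a - 1) / Gamma a\<close> for the kernel of the fractional integral \<open>J\<^sup>a\<close>, and
  \<open>e n \<tau> = \<tau> powr (\<alpha> - 1) * E(- lam n * \<tau> powr \<alpha>)\<close> with \<open>E\<close> the Mittag-Leffler function of indices
  \<open>(\<alpha>, \<alpha>)\<close>. The observation is \<open>\<Sum>n. c n * y n\<close> with \<open>c n = ip (P n f) \<psi>\<close> and \<open>y n = e n * p\<close>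
  (convolution). The kernel \<open>e n\<close> solves the Volterra equation \<open>e n + lam n J\<^sup>\<alpha> (e n) = g \<alpha>\<close>, hence
  \<open>y n = J\<^sup>\<alpha> p - lam n J\<^sup>\<alpha> (y n)\<close>. As \<open>\<psi>\<close> lies in the domain of the operator, \<open>\<Sum>n. lam n * norm (c n)\<close>
  converges, and summation over \<open>n\<close> shows that the observation is \<open>J\<^sup>\<alpha> (p * ip f \<psi> - v)\<close> with
  \<open>v = \<Sum>n. lam n * y n * c n\<close>. This is the evolution equation paired with \<open>\<psi>\<close>. Its fractional
  derivative of order \<open>\<gamma>\<close> is therefore \<open>J\<^sup>\<alpha>\<^sup>-\<^sup>\<gamma> (p * ip f \<psi> - v)\<close>.

  The bound \<open>0 \<le> e n \<le> g \<alpha>\<close> makes \<open>v\<close> of size \<open>t powr \<alpha>\<close>, uniformly in \<open>p\<close> and \<open>\<alpha>\<close>, while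
  \<open>p\<close> differs from its initial value by \<open>M t\<close> at most. So for small \<open>t\<close> the differentiated data are
  \<open>c g (\<alpha> - \<gamma> + 1) t\<close> up to an error of size \<open>t powr (2 \<alpha> - \<gamma>)\<close>, where \<open>c\<close> is the product of the
  initial value of the source with \<open>ip f \<psi>\<close>: the leading term reveals the order and depends on the
  source through its initial value only (\<open>data_distance_lower_bound\<close>).

  For two orders \<open>\<alpha> \<le> \<beta>\<close> the leading terms differ by at least a constant times
  \<open>t powr (\<alpha> - \<gamma>) * min ((\<beta> - \<alpha>) \<bar>ln t\<bar>) 1\<close> (\<open>rl_kernel_gap\<close>). If the data differ by
  \<open>\<epsilon>\<close> at most, then \<open>min ((\<beta> - \<alpha>) \<bar>ln t\<bar>) 1\<close> is at most a constant times
  \<open>\<epsilon> t powr (\<gamma> - \<alpha>) + t powr \<alpha>\<close>. Both terms are \<open>\<epsilon> powr (\<alpha> / (2 \<alpha> - \<gamma>))\<close> at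
  \<open>t = \<epsilon> powr (1 / (2 \<alpha> - \<gamma>))\<close>, and this exponent decreases in \<open>\<alpha>\<close>, so that its value at the
  largest admissible order bounds the right-hand side. For small \<open>\<epsilon>\<close> the right-hand side is below
  the threshold at which the minimum could be \<open>1\<close>; what remains is the claim, with the logarithm
  coming from \<open>\<bar>ln t\<bar>\<close> (\<open>order_gap_bound\<close>). If the data agree, the estimate holds for every small
  \<open>\<epsilon> > 0\<close> and \<open>\<epsilon> \<rightarrow> 0\<close> gives equality of the orders.

  Three ingredients of this argument are substantial in themselves: the positivity of \<open>e n\<close>
  (\<open>ml_kernel_nonneg\<close>), the injectivity of the fractional integral modulo null sets, through which
  the fractional derivative is determined (\<open>frac_deriv_eqI\<close>), and the completeness
  \<open>x = \<Sum>n. P n x\<close> of the spectral projections (\<open>P_sums\<close>).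
\<close>

section \<open>Fractional integration kernels\<close>

definition rl_kernel :: "real \<Rightarrow> real \<Rightarrow> real" where
  "rl_kernel a \<tau> = (if 0 < \<tau> then \<tau> powr (a - 1) / Gamma a else 0)"

lemma rl_kernel_nonneg: "0 < a \<Longrightarrow> 0 \<le> rl_kernel a \<tau>"
  by (simp add: rl_kernel_def Gamma_real_pos less_imp_le)

lemma rl_kernel_measurable [measurable]: "rl_kernel a \<in> borel_measurable borel"
  unfolding rl_kernel_def[abs_def] by measurable

lemma rl_kernel_eq_0 [simp]: "\<tau> \<le> 0 \<Longrightarrow> rl_kernel a \<tau> = 0"
  by (simp add: rl_kernel_def)

lemma rl_kernel_1: "rl_kernel 1 \<tau> = indicator {0<..} \<tau>"
  by (simp add: rl_kernel_def)

text \<open>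
  The semigroup law \<open>J\<^sup>a J\<^sup>b = J\<^sup>a\<^sup>+\<^sup>b\<close> for kernels: scaling the variable by \<open>t\<close> turns the convolution
  into the Beta integral. Stated for nonnegative integrals, it also yields the integrability that
  Fubini arguments require.
\<close>

lemma nn_integral_rl_kernel_conv:
  assumes a: "0 < a" and b: "0 < b"
  shows "(\<integral>\<^sup>+ s. ennreal (rl_kernel a (t - s) * rl_kernel b s) \<partial>lborel) = ennreal (rl_kernel (a + b) t)"
proof (cases "0 < t")
  case False
  have "rl_kernel a (t - s) * rl_kernel b s = 0" for s
    using False by (cases "0 < s") auto
  then have "(\<lambda>s. ennreal (rl_kernel a (t - s) * rl_kernel b s)) = (\<lambda>s. 0)" by (auto simp only: ennreal_0)
  with False show ?thesis by simp
next
  case True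
  let ?C = "t powr (a + b - 2) / (Gamma a * Gamma b)"
  have C: "0 \<le> ?C" using Gamma_real_pos[OF a] Gamma_real_pos[OF b] by simp
  have beta: "(\<integral>\<^sup>+ x. ennreal (x powr (b - 1) * (1 - x) powr (a - 1)) * indicator {0..1} x \<partial>lborel)
      = ennreal (Beta b a)"
    by (rule nn_integral_has_integral_lebesgue'[OF _ has_integral_Beta_real[OF b a]]) auto
  have pt: "ennreal (rl_kernel a (t - (0 + t * x)) * rl_kernel b (0 + t * x))
      = ennreal ?C * (ennreal (x powr (b - 1) * (1 - x) powr (a - 1)) * indicator {0..1} x)" 
    if x: "x \<noteq> 0" "x \<noteq> 1" for x
  proof (cases "0 < x \<and> x < 1")
    case x: True
    have "t - t * x = t * (1 - x)" by (simp add: algebra_simps)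
    moreover have "0 < t * (1 - x)" using x True by simp
    moreover have "t powr (a + b - 2) = t powr (a - 1) * t powr (b - 1)"
      by (simp flip: powr_add)
    ultimately have "rl_kernel a (t - t * x) * rl_kernel b (t * x)
        = ?C * (x powr (b - 1) * (1 - x) powr (a - 1))"
      using x True by (simp add: rl_kernel_def powr_mult)
    then have "ennreal (rl_kernel a (t - (0 + t * x)) * rl_kernel b (0 + t * x))
        = ennreal (?C * (x powr (b - 1) * (1 - x) powr (a - 1)))" by simp
    also have "\<dots> = ennreal ?C * ennreal (x powr (b - 1) * (1 - x) powr (a - 1))"
      by (rule ennreal_mult'[OF C])
    finally show ?thesis using x by simp
  next
    case False
    then have "x < 0 \<or> x > 1" using x by linarith
    then have "t * x \<le> 0 \<or> t - t * x \<le> 0"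
      using True by (auto simp: mult_le_0_iff)
    with False x show ?thesis by (auto simp: indicator_def)
  qed
  have "(\<integral>\<^sup>+ s. ennreal (rl_kernel a (t - s) * rl_kernel b s) \<partial>lborel)
      = ennreal \<bar>t\<bar> * (\<integral>\<^sup>+ x. ennreal (rl_kernel a (t - (0 + t * x)) * rl_kernel b (0 + t * x)) \<partial>lborel)"
    by (rule nn_integral_real_affine) (use True in auto)
  also have "(\<integral>\<^sup>+ x. ennreal (rl_kernel a (t - (0 + t * x)) * rl_kernel b (0 + t * x)) \<partial>lborel)
      = (\<integral>\<^sup>+ x. ennreal ?C * (ennreal (x powr (b - 1) * (1 - x) powr (a - 1)) * indicator {0..1} x) \<partial>lborel)"
  proof (rule nn_integral_cong_AE)
    have "AE x in lborel. x \<noteq> (0::real)" "AE x in lborel. x \<noteq> (1::real)"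
      by (rule AE_lborel_singleton)+
    then show "AE x in lborel. ennreal (rl_kernel a (t - (0 + t * x)) * rl_kernel b (0 + t * x))
      = ennreal ?C * (ennreal (x powr (b - 1) * (1 - x) powr (a - 1)) * indicator {0..1} x)"
      by eventually_elim (rule pt)
  qed
  also have "\<dots> = ennreal ?C * ennreal (Beta b a)"
    by (subst nn_integral_cmult) (auto simp: beta)
  also have "ennreal \<bar>t\<bar> * (ennreal ?C * ennreal (Beta b a)) = ennreal (\<bar>t\<bar> * (?C * Beta b a))"
    by (simp only: ennreal_mult'[OF C] ennreal_mult'[OF abs_ge_zero])
  also have "\<bar>t\<bar> * (?C * Beta b a) = rl_kernel (a + b) t"
  proof -
    have "t powr (a + b - 1) = t powr 1 * t powr (a + b - 2)"
      by (simp only: powr_add[symmetric]) simp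
    then show ?thesis
      using True Gamma_real_pos[OF a] Gamma_real_pos[OF b]
      by (simp add: rl_kernel_def Beta_def field_simps)
  qed
  finally show ?thesis .
qed

lemma
  assumes a: "0 < a" and b: "0 < b"
  shows rl_kernel_conv: "(\<integral> s. rl_kernel a (t - s) * rl_kernel b s \<partial>lborel) = rl_kernel (a + b) t"
    and integrable_rl_kernel_conv: "integrable lborel (\<lambda>s. rl_kernel a (t - s) * rl_kernel b s)"
proof -
  have "has_bochner_integral lborel (\<lambda>s. rl_kernel a (t - s) * rl_kernel b s) (rl_kernel (a + b) t)"
    by (rule has_bochner_integral_nn_integral)
      (use nn_integral_rl_kernel_conv[OF a b] in \<open>auto simp: rl_kernel_nonneg a b add_pos_pos\<close>)
  then show "(\<integral> s. rl_kernel a (t - s) * rl_kernel b s \<partial>lborel) = rl_kernel (a + b) t"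
    "integrable lborel (\<lambda>s. rl_kernel a (t - s) * rl_kernel b s)"
    by (simp_all add: has_bochner_integral_iff)
qed

text \<open>
  Only the part of the Gamma integral over \<open>[R, R + 1]\<close> is kept. Since \<open>R\<close> is free, this shows that
  \<open>Gamma\<close> outgrows every geometric sequence, and \<open>R = 1\<close> gives a lower bound that is uniform in \<open>x\<close>.
\<close>

lemma Gamma_lower_bound:
  assumes x: "1 \<le> x" and R: "0 \<le> R"
  shows "R powr (x - 1) * exp (- (R + 1)) \<le> Gamma (x::real)"
proof -
  let ?f = "\<lambda>t. t powr (x - 1) / exp t" and ?c = "R powr (x - 1) * exp (- (R + 1))"
  have f: "(?f has_integral Gamma x) {0..}"
    by (rule Gamma_integral_real) (use x in auto)
  have "?f integrable_on {R..R+1}"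
    by (rule integrable_on_subinterval[OF has_integral_integrable[OF f]]) (use R in auto)
  then obtain I where I: "(?f has_integral I) {R..R+1}" by blast
  have c: "((\<lambda>t. ?c) has_integral ?c) {R..R+1}"
    using has_integral_const_real[of ?c R "R + 1"] by simp
  have "?c \<le> I"
  proof (rule has_integral_le[OF c I])
    fix t assume t: "t \<in> {R..R+1}"
    have "R powr (x - 1) \<le> t powr (x - 1)"
      using t R x by (intro powr_mono2) auto
    moreover have "exp (- (R + 1)) \<le> exp (- t)" using t by simp
    ultimately have "?c \<le> t powr (x - 1) * exp (- t)"
      by (intro mult_mono) auto
    then show "?c \<le> ?f t" by (simp add: exp_minus field_simps)
  qed
  also have "I \<le> Gamma x"
    by (rule has_integral_subset_le[OF _ I f]) (use R in auto)
  finally show ?thesis .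
qed

section \<open>The Volterra equation of the Mittag-Leffler kernel\<close>

text \<open>
  \<open>Gamma_lower_bound\<close> with \<open>R powr a = 2 * norm z + 1\<close> dominates the series by a geometric one of
  ratio \<open>1 / 2\<close>.
\<close>

lemma summable_mittag_leffler:
  fixes z :: "'a::{real_normed_field,banach}"
  assumes a: "0 < a" and b: "0 < b"
  shows "summable (\<lambda>k. norm (z ^ k /\<^sub>R Gamma (a * real k + b)))"
proof -
  define R where "R = (2 * norm z + 1) powr (1 / a)"
  have z: "0 < 2 * norm z + 1" by (simp add: add_nonneg_pos)
  then have R: "0 < R" unfolding R_def powr_gt_zero by simp
  have Ra: "R powr a = 2 * norm z + 1"
    using a z by (simp add: R_def powr_powr)
  obtain N :: nat where N: "1 / a < N" using reals_Archimedean2 by blast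
  let ?c = "exp (R + 1) * R powr (1 - b)"
  have "norm (norm (z ^ k /\<^sub>R Gamma (a * real k + b))) \<le> ?c * (1 / 2) ^ k" if k: "k \<ge> N" for k
  proof -
    have "1 / a < k" using N k by simp
    then have "1 < a * k" using a by (simp add: field_simps)
    then have x: "1 \<le> a * k + b" using b by simp
    have "R powr (a * k + b - 1) = (R powr a) ^ k * R powr (b - 1)"
      using R by (simp add: powr_add[symmetric] powr_powr powr_realpow[symmetric] algebra_simps)
    also have "\<dots> = (2 * norm z + 1) ^ k * R powr (b - 1)" by (simp add: Ra)
    finally have G: "(2 * norm z + 1) ^ k * R powr (b - 1) * exp (- (R + 1)) \<le> Gamma (a * k + b)"
      using Gamma_lower_bound[OF x, of R] R by simp
    have Gp: "0 < Gamma (a * k + b)" using x by (intro Gamma_real_pos) auto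
    have pos: "0 < (2 * norm z + 1) ^ k * R powr (b - 1) * exp (- (R + 1))"
      using R by (simp add: add_nonneg_pos)
    have "norm (z ^ k /\<^sub>R Gamma (a * k + b)) = norm z ^ k / Gamma (a * k + b)"
      using Gp by (simp add: norm_power divide_inverse)
    also have "\<dots> \<le> norm z ^ k / ((2 * norm z + 1) ^ k * R powr (b - 1) * exp (- (R + 1)))"
      using G pos Gp by (intro divide_left_mono) auto
    also have "\<dots> = ?c * (norm z / (2 * norm z + 1)) ^ k"
    proof -
      have "exp (- (R + 1)) = 1 / exp (R + 1)" by (simp only: exp_minus inverse_eq_divide)
      moreover have "R powr (1 - b) = 1 / R powr (b - 1)"
        using powr_minus_divide[of R "b - 1"] by simp
      ultimately show ?thesis by (simp only: power_divide) (use R z in \<open>simp add: mult.commute\<close>)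
    qed
    also have "\<dots> \<le> ?c * (1 / 2) ^ k"
      using z by (intro mult_left_mono power_mono) (auto simp: divide_le_eq)
    finally show ?thesis by simp
  qed
  then show ?thesis
    by (intro summable_comparison_test[OF _ summable_mult[OF summable_geometric]]) auto
qed

definition ml_kernel :: "real \<Rightarrow> real \<Rightarrow> real \<Rightarrow> real" where
  "ml_kernel a l \<tau> = (if 0 < \<tau> then \<tau> powr (a - 1) * mittag_leffler a a (- l * \<tau> powr a) else 0)"

lemma ml_kernel_eq_0 [simp]: "\<tau> \<le> 0 \<Longrightarrow> ml_kernel a l \<tau> = 0"
  by (simp add: ml_kernel_def)

lemma mittag_leffler_derivative:
  assumes a: "0 < a" and b: "0 < b"
  obtains E' :: "real \<Rightarrow> real"
  where "\<And>z. (mittag_leffler a b has_real_derivative E' z) (at z)"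
proof -
  let ?c = "\<lambda>k. 1 / Gamma (a * real k + b) :: real"
  have "summable (\<lambda>k. ?c k * y ^ k)" for y
    using summable_norm_cancel[OF summable_mittag_leffler[OF a b, of y]]
    by (simp add: divide_inverse mult.commute)
  note d = termdiffs_strong_converges_everywhere[OF this]
  have "mittag_leffler a b = (\<lambda>z. \<Sum>k. ?c k * z ^ k)"
    by (simp add: mittag_leffler_def fun_eq_iff divide_inverse mult.commute)
  with d that show ?thesis by metis
qed

lemma mittag_leffler_continuous:
  assumes a: "0 < a" and b: "0 < b"
  shows "continuous_on UNIV (mittag_leffler a b :: real \<Rightarrow> real)"
  using mittag_leffler_derivative[OF a b] 
  by (metis DERIV_isCont continuous_at_imp_continuous_on)

lemma ml_kernel_measurable [measurable]:
  assumes "0 < a"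
  shows "ml_kernel a l \<in> borel_measurable borel"
proof -
  have [measurable]: "(mittag_leffler a a :: real \<Rightarrow> real) \<in> borel_measurable borel"
    by (intro borel_measurable_continuous_onI mittag_leffler_continuous assms)
  show ?thesis unfolding ml_kernel_def[abs_def] by measurable
qed

lemma ml_kernel_sums:
  assumes a: "0 < a"
  shows "(\<lambda>k. (- l) ^ k * rl_kernel (a * real k + a) \<tau>) sums ml_kernel a l \<tau>"
    and "summable (\<lambda>k. norm ((- l) ^ k * rl_kernel (a * real k + a) \<tau>))"
proof -
  have eq: "(- l) ^ k * rl_kernel (a * real k + a) \<tau>
      = \<tau> powr (a - 1) * ((- l * \<tau> powr a) ^ k /\<^sub>R Gamma (a * real k + a))" if "0 < \<tau>" for k
  proof -
    have "\<tau> powr (a * k + a - 1) = \<tau> powr (a - 1) * (\<tau> powr a) ^ k"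
      using that by (simp add: powr_add[symmetric] powr_powr powr_realpow[symmetric] algebra_simps)
    moreover have "(- l * \<tau> powr a) ^ k = (- l) ^ k * (\<tau> powr a) ^ k"
      by (rule power_mult_distrib)
    ultimately show ?thesis using that by (simp add: rl_kernel_def divide_inverse)
  qed
  note s = summable_mittag_leffler[OF a a, of "- l * \<tau> powr a"]
  show "summable (\<lambda>k. norm ((- l) ^ k * rl_kernel (a * real k + a) \<tau>))"
  proof (cases "0 < \<tau>")
    case True
    from summable_mult[OF s, of "\<tau> powr (a - 1)"] True show ?thesis
      by (simp only: eq norm_mult) simp
  qed simp
  show "(\<lambda>k. (- l) ^ k * rl_kernel (a * real k + a) \<tau>) sums ml_kernel a l \<tau>"
  proof (cases "0 < \<tau>")
    case True
    have "(\<lambda>k. (- l * \<tau> powr a) ^ k /\<^sub>R Gamma (a * real k + a)) sums mittag_leffler a a (- l * \<tau> powr a)"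
      unfolding mittag_leffler_def by (rule summable_sums[OF summable_norm_cancel[OF s]])
    from sums_mult[OF this, of "\<tau> powr (a - 1)"] True show ?thesis
      by (simp only: eq) (simp add: ml_kernel_def)
  qed simp
qed

text \<open>
  By \<open>ml_kernel_sums\<close> the Mittag-Leffler kernel is the Neumann series
  \<open>\<Sum>k. (- l) ^ k * rl_kernel (a (k + 1))\<close>. Convolution with \<open>rl_kernel a\<close> shifts it by one term, and absolute
  convergence of the series with \<open>\<bar>l\<bar>\<close> in place of \<open>l\<close> justifies integration term by term.
\<close>

lemma
  assumes a: "0 < a"
  shows integrable_ml_kernel_conv: "integrable lborel (\<lambda>s. rl_kernel a (t - s) * ml_kernel a l s)"
    and ml_kernel_volterra:
      "ml_kernel a l t + l * (\<integral> s. rl_kernel a (t - s) * ml_kernel a l s \<partial>lborel) = rl_kernel a t"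
proof -
  let ?f = "\<lambda>k s. rl_kernel a (t - s) * ((- l) ^ k * rl_kernel (a * real k + a) s)"
  have pos: "0 < a * real k + a" for k using a by (simp add: add_nonneg_pos)
  have int: "integrable lborel (?f k)" for k
    using integrable_mult_right[OF integrable_rl_kernel_conv[OF a pos], of "(- l) ^ k" t k]
    by (simp add: mult.left_commute)
  have sm: "AE s in lborel. summable (\<lambda>k. norm (?f k s))"
  proof (rule AE_I2)
    fix s
    show "summable (\<lambda>k. norm (?f k s))"
      using summable_mult[OF ml_kernel_sums(2)[OF a, of l s], of "norm (rl_kernel a (t - s))"]
      by (simp only: norm_mult)
  qed
  have k2: "a + (a * real k + a) = a * real (Suc k) + a" for k by (simp add: algebra_simps)
  have ival: "(\<integral> s. ?f k s \<partial>lborel) = (- l) ^ k * rl_kernel (a * real (Suc k) + a) t" for k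
  proof -
    have "(\<integral> s. ?f k s \<partial>lborel) = (\<integral> s. (- l) ^ k * (rl_kernel a (t - s) * rl_kernel (a * real k + a) s) \<partial>lborel)"
      by (simp only: mult.left_commute)
    also have "\<dots> = (- l) ^ k * rl_kernel (a * real (Suc k) + a) t"
      by (simp only: integral_mult_right_zero rl_kernel_conv[OF a pos] k2)
    finally show ?thesis .
  qed
  have inorm: "(\<integral> s. norm (?f k s) \<partial>lborel) = norm ((- \<bar>l\<bar>) ^ k * rl_kernel (a * real (Suc k) + a) t)" for k
  proof -
    have "(\<integral> s. norm (?f k s) \<partial>lborel)
        = (\<integral> s. \<bar>l\<bar> ^ k * (rl_kernel a (t - s) * rl_kernel (a * real k + a) s) \<partial>lborel)"
      by (simp add: abs_mult power_abs rl_kernel_nonneg a pos mult.left_commute)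
    also have "\<dots> = \<bar>l\<bar> ^ k * rl_kernel (a * real (Suc k) + a) t"
      by (simp only: integral_mult_right_zero rl_kernel_conv[OF a pos] k2)
    also have "\<dots> = norm ((- \<bar>l\<bar>) ^ k * rl_kernel (a * real (Suc k) + a) t)"
      using rl_kernel_nonneg[OF pos[of "Suc k"], of t]  by (simp add: abs_mult power_abs del: of_nat_Suc)
    finally show ?thesis .
  qed
  have ssm: "summable (\<lambda>k. \<integral> s. norm (?f k s) \<partial>lborel)"
  proof (cases "l = 0")
    case True
    have "(\<integral> s. norm (?f k s) \<partial>lborel) = 0" if "k \<notin> {0}" for k
      unfolding inorm using that by (simp add: True)
    then show ?thesis by (intro summable_finite[of "{0}"]) auto
  next
    case False
    have "summable (\<lambda>k. norm ((- \<bar>l\<bar>) ^ Suc k * rl_kernel (a * real (Suc k) + a) t))"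
      using ml_kernel_sums(2)[OF a, of "\<bar>l\<bar>" t] by (rule summable_Suc_iff[THEN iffD2])
    then have "summable (\<lambda>k. \<bar>l\<bar> * norm ((- \<bar>l\<bar>) ^ k * rl_kernel (a * real (Suc k) + a) t))"
      by (simp add: abs_mult mult.assoc)
    from summable_mult[OF this, of "1 / \<bar>l\<bar>"] show ?thesis unfolding inorm using False by simp
  qed
  have sum_eq: "(\<Sum>k. ?f k s) = rl_kernel a (t - s) * ml_kernel a l s" for s
    using sums_unique[OF sums_mult[OF ml_kernel_sums(1)[OF a, of l s], of "rl_kernel a (t - s)"]] by simp
  show "integrable lborel (\<lambda>s. rl_kernel a (t - s) * ml_kernel a l s)"
    using integrable_suminf[OF int sm ssm] by (simp only: sum_eq)
  have "(\<lambda>k. (- l) ^ k * rl_kernel (a * real (Suc k) + a) t) sums (\<integral> s. rl_kernel a (t - s) * ml_kernel a l s \<partial>lborel)"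
    using sums_integral[OF int sm ssm] by (simp only: sum_eq ival)
  from sums_mult[OF this, of "- l"]
  have "(\<lambda>k. (- l) ^ Suc k * rl_kernel (a * real (Suc k) + a) t) sums
      (- l * (\<integral> s. rl_kernel a (t - s) * ml_kernel a l s \<partial>lborel))"
    by (simp add: mult.assoc)
  from sums_Suc[OF this]
  have "(\<lambda>k. (- l) ^ k * rl_kernel (a * real k + a) t) sums
      (- l * (\<integral> s. rl_kernel a (t - s) * ml_kernel a l s \<partial>lborel) + rl_kernel a t)"
    by simp
  from sums_unique2[OF this ml_kernel_sums(1)[OF a]]
  show "ml_kernel a l t + l * (\<integral> s. rl_kernel a (t - s) * ml_kernel a l s \<partial>lborel) = rl_kernel a t"
    by simp
qed

section \<open>Positivity of the Mittag-Leffler kernel\<close>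

text \<open>
  The derivative of \<open>x powr (a - 1)\<close> has absolute value at least \<open>1 - a\<close> on \<open>(0, 1)\<close>.
\<close>

lemma powr_neg_diff_ge:
  fixes u v a :: real
  assumes "0 < u" "u < v" "v < 1" "a < 1"
  shows "(1 - a) * (v - u) \<le> u powr (a - 1) - v powr (a - 1)"
proof -
  have "\<exists>\<xi>. u < \<xi> \<and> \<xi> < v \<and> v powr (a - 1) - u powr (a - 1) = (v - u) * ((a - 1) * \<xi> powr (a - 1 - 1))"
    by (rule MVT2) (use assms in \<open>auto intro!: DERIV_powr[THEN DERIV_cong] derivative_eq_intros simp: field_simps\<close>)
  then obtain \<xi> where \<xi>: "u < \<xi>" "\<xi> < v"
    "v powr (a - 1) - u powr (a - 1) = (v - u) * ((a - 1) * \<xi> powr (a - 1 - 1))" by blast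
  have "1 \<le> \<xi> powr (a - 1 - 1)"
    using powr_mono'[of "a - 1 - 1" 0 \<xi>] \<xi> assms by simp
  then have "((1 - a) * (v - u)) * 1 \<le> ((1 - a) * (v - u)) * \<xi> powr (a - 1 - 1)"
    using assms by (intro mult_left_mono) auto
  also have "\<dots> = u powr (a - 1) - v powr (a - 1)" using \<xi>(3) by (simp add: algebra_simps)
  finally show ?thesis by simp
qed

lemma first_zero:
  fixes m :: "real \<Rightarrow> real"
  assumes c: "continuous_on {0..} m" and "0 < m 0" and "0 \<le> t1" "m t1 < 0"
  obtains t0 where "0 < t0" "m t0 = 0" "\<And>s. 0 \<le> s \<Longrightarrow> s < t0 \<Longrightarrow> 0 < m s"
proof -
  let ?Z = "{t\<in>{0..t1}. m t = 0}"
  have zero: "\<exists>s\<in>{0..t}. m s = 0" if "0 \<le> t" "m t \<le> 0" for t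
  proof -
    have "continuous_on {0..t} m" by (rule continuous_on_subset[OF c]) auto
    with IVT2'[of m t 0 0] that assms show ?thesis by auto
  qed
  have cl: "closed ?Z"
    by (intro continuous_closed_preimage_constant continuous_on_subset[OF c]) auto
  have ne: "?Z \<noteq> {}" using zero[of t1] assms by auto
  have bd: "bdd_below ?Z" by (auto intro: bdd_belowI[of _ 0])
  have In: "Inf ?Z \<in> ?Z" by (rule closed_contains_Inf[OF ne bd cl])
  show thesis
  proof
    show "m (Inf ?Z) = 0" using In by simp
    then show "0 < Inf ?Z" using In \<open>0 < m 0\<close> by (cases "Inf ?Z = 0") auto
    show "0 < m s" if s: "0 \<le> s" "s < Inf ?Z" for s
    proof (rule ccontr)
      assume "\<not> 0 < m s"
      then obtain r where r: "r \<in> {0..s}" "m r = 0" using zero[of s] s by force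
      then have "r \<in> ?Z" using s In by auto
      then have "Inf ?Z \<le> r" by (rule cInf_lower[OF _ bd])
      then show False using r s by auto
    qed
  qed
qed

text \<open>
  Suppose the kernel \<open>e\<close> became negative and let \<open>t0\<close> be the first zero of \<open>e / g\<close>, where \<open>g\<close> is
  \<open>rl_kernel a\<close>. Divided by
  \<open>g r\<close>, the Volterra equation reads \<open>e r / g r + l * (\<integral> k r s * e s) = 1\<close> with
  \<open>k r s = (1 - s / r) powr (a - 1)\<close> for \<open>s < r\<close>. This weight decreases in \<open>r\<close>. Passing from \<open>t < t0\<close> to \<open>t0\<close>
  therefore lowers the integral over \<open>(0, t)\<close>, by an amount of order \<open>h = t0 - t\<close> because \<open>e\<close> is
  positive there, whereas the new piece over \<open>(t, t0)\<close> contributes only \<open>O(h powr (1 + a))\<close> because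
  \<open>e\<close> is differentiable and vanishes at \<open>t0\<close>. For small \<open>h\<close> the integral is smaller at \<open>t0\<close> than
  at \<open>t\<close>, so \<open>e t0 > 0\<close>, a contradiction.
\<close>

lemma ml_kernel_nonneg:
  assumes a: "0 < a" "a < 1" and l: "0 < l"
  shows "0 \<le> ml_kernel a l t1"
proof (rule ccontr)
  let ?e = "ml_kernel a l"
  define m where "m t = mittag_leffler a a (- l * t powr a)" for t
  assume neg: "\<not> ?thesis"
  then have t1: "0 < t1" by (cases "0 < t1") auto
  have e_m: "?e t = t powr (a - 1) * m t" if "0 < t" for t
    using that by (simp add: ml_kernel_def m_def)
  have mt1: "m t1 < 0" using neg e_m[OF t1] t1 by (simp add: zero_le_mult_iff)
  have "continuous_on {0..} m"
    unfolding m_def using a(1)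
    by (intro continuous_on_compose2[OF mittag_leffler_continuous] continuous_intros continuous_on_powr') auto
  moreover have "0 < m 0"
    using a by (simp add: m_def mittag_leffler_def powser_zero[unfolded mult.commute[of _ "_ ^ _"]] suminf_finite[of "{0}"])
  ultimately obtain t0 where t0: "0 < t0" "m t0 = 0" and mpos: "\<And>s. 0 \<le> s \<Longrightarrow> s < t0 \<Longrightarrow> 0 < m s"
    using first_zero[of m t1] t1 mt1 by auto
  have epos: "0 < ?e s" if "0 < s" "s < t0" for s using that mpos[of s] e_m[of s] by simp
  have et0: "?e t0 = 0" using t0 e_m by simp
  obtain E' where E': "\<And>z. (mittag_leffler a a has_real_derivative E' z) (at z)"
    using mittag_leffler_derivative[OF a(1) a(1)] by metis
  have "(?e has_real_derivative
      ((a - 1) * t0 powr (a - 1 - 1) * m t0 + E' (- l * t0 powr a) * (- l * (a * t0 powr (a - 1))) * t0 powr (a - 1))) (at t0)"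
  proof (rule has_field_derivative_transform_within_open[where S="{0<..}"])
    show "((\<lambda>t. t powr (a - 1) * m t) has_real_derivative
      ((a - 1) * t0 powr (a - 1 - 1) * m t0 + E' (- l * t0 powr a) * (- l * (a * t0 powr (a - 1))) * t0 powr (a - 1))) (at t0)"
      unfolding m_def using t0
      by (auto intro!: DERIV_mult DERIV_chain2[OF E'] derivative_eq_intros simp: field_simps)
  qed (use t0 e_m in auto)
  then obtain d where d: "(?e has_real_derivative d) (at t0)" by blast
  then have "((\<lambda>h. (?e (t0 + h) - ?e t0) / h) \<longlongrightarrow> d) (at 0)"
    by (simp add: DERIV_def)
  from tendstoD[OF this zero_less_one] obtain \<eta> where \<eta>: "0 < \<eta>"
    "\<And>h. h \<noteq> 0 \<Longrightarrow> \<bar>h\<bar> < \<eta> \<Longrightarrow> \<bar>?e (t0 + h) / h - d\<bar> < 1"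
    by (auto simp: eventually_at dist_real_def et0)
  define L where "L = \<bar>d\<bar> + 1"
  have L: "0 < L" by (simp add: L_def)
  have lip: "?e s \<le> L * (t0 - s)" if s: "t0 - \<eta> < s" "s < t0" for s
  proof -
    have "\<bar>?e s / (s - t0) - d\<bar> < 1" using \<eta>(2)[of "s - t0"] s by simp
    then have "\<bar>?e s / (s - t0)\<bar> \<le> L" unfolding L_def by arith
    then have "\<bar>?e s\<bar> \<le> L * \<bar>s - t0\<bar>" using s by (simp add: field_simps abs_divide)
    then show ?thesis using s by simp
  qed
  have "continuous_on {t0/4..t0/2} ?e"
  proof (rule continuous_on_eq)
    show "continuous_on {t0/4..t0/2} (\<lambda>t. t powr (a - 1) * m t)"
      using t0 by (intro continuous_intros continuous_on_subset[OF \<open>continuous_on {0..} m\<close>]) auto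
  qed (use t0 e_m in auto)
  then obtain s0 where s0: "s0 \<in> {t0/4..t0/2}" "\<And>s. s \<in> {t0/4..t0/2} \<Longrightarrow> ?e s0 \<le> ?e s"
    using continuous_attains_inf[of "{t0/4..t0/2}" ?e] t0 by auto
  define c where "c = ?e s0"
  have c: "0 < c" using epos[of s0] s0(1) t0 by (simp add: c_def)
  define K where "K = L * t0 powr (1 - a)"
  have K: "0 < K" using L t0 by (simp add: K_def)
  \<comment> \<open>The gain over \<open>(t, t0)\<close> is at most \<open>K * h powr a * h\<close>, and the loss over \<open>[t0 / 4, t0 / 2]\<close>
    alone is at least \<open>(1 - a) * c / 16 * h\<close>; for \<open>h powr a \<le> \<kappa>\<close> the loss prevails.\<close>
  define \<kappa> where "\<kappa> = (1 - a) * c / (16 * K)"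
  have \<kappa>: "0 < \<kappa>" using a c K by (simp add: \<kappa>_def)
  define h where "h = Min {\<eta> / 2, t0 / 4, \<kappa> powr (1 / a)}"
  have h: "0 < h" "h \<le> \<eta> / 2" "h \<le> t0 / 4" "h \<le> \<kappa> powr (1 / a)"
    using \<eta> t0 \<kappa> by (auto simp: h_def)
  have ha: "h powr a \<le> \<kappa>"
    using powr_mono2[of a h "\<kappa> powr (1 / a)"] h a \<kappa> by (simp add: powr_powr)
  define t where "t = t0 - h"
  have t: "0 < t" "t < t0" "t0 / 2 < t" "t0 - \<eta> < t" using h t0 \<eta> by (auto simp: t_def)
  define k where "k r s = Gamma a * r powr (1 - a) * rl_kernel a (r - s)" for r s
  have k_eq: "k r s = (1 - s / r) powr (a - 1)" if "0 < r" "s < r" for r s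
  proof -
    have "k r s = r powr (1 - a) * (r - s) powr (a - 1)"
      using that a by (simp add: k_def rl_kernel_def less_imp_neq[OF Gamma_real_pos, symmetric])
    also have "r powr (1 - a) = 1 / r powr (a - 1)"
      using powr_minus_divide[of r "a - 1"] by simp
    also have "1 / r powr (a - 1) * (r - s) powr (a - 1) = (1 - s / r) powr (a - 1)"
      using that by (simp add: powr_divide[symmetric] diff_divide_distrib)
    finally show ?thesis .
  qed
  have kint: "integrable lborel (\<lambda>s. k r s * ?e s)" for r
    using integrable_mult_right[OF integrable_ml_kernel_conv[OF a(1), of r l], of "Gamma a * r powr (1 - a)"]
    by (simp add: k_def mult.assoc)
  have kvol: "Gamma a * r powr (1 - a) * ?e r + l * (\<integral> s. k r s * ?e s \<partial>lborel) = 1" if "0 < r" for r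
  proof -
    have "(\<integral> s. k r s * ?e s \<partial>lborel) = Gamma a * r powr (1 - a) * (\<integral> s. rl_kernel a (r - s) * ?e s \<partial>lborel)"
      by (simp add: k_def mult.assoc)
    then have "Gamma a * r powr (1 - a) * ?e r + l * (\<integral> s. k r s * ?e s \<partial>lborel)
        = Gamma a * r powr (1 - a) * (?e r + l * (\<integral> s. rl_kernel a (r - s) * ?e s \<partial>lborel))"
      by (simp add: algebra_simps)
    also have "\<dots> = Gamma a * r powr (1 - a) * rl_kernel a r" by (simp only: ml_kernel_volterra[OF a(1)])
    also have "\<dots> = 1"
      using that a powr_add[of r "1 - a" "a - 1"]
      by (simp add: rl_kernel_def less_imp_neq[OF Gamma_real_pos, symmetric])
    finally show ?thesis .
  qed
  have "l * (\<integral> s. k t s * ?e s \<partial>lborel) < l * (\<integral> s. k t0 s * ?e s \<partial>lborel)"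
  proof -
    have "0 < Gamma a * t powr (1 - a) * ?e t" using t a epos[of t] by simp
    then show ?thesis using kvol[OF t(1)] kvol[OF t0(1)] et0 by simp
  qed
  then have "0 < (\<integral> s. k t0 s * ?e s \<partial>lborel) - (\<integral> s. k t s * ?e s \<partial>lborel)"
    using l by simp
  also have "\<dots> = (\<integral> s. k t0 s * ?e s - k t s * ?e s \<partial>lborel)"
    by (rule Bochner_Integration.integral_diff[symmetric]) (rule kint)+
  also have "\<dots> \<le> (\<integral> s. K * h powr a * indicator {t..t0} s
      - (1 - a) * h / (4 * t0) * c * indicator {t0/4..t0/2} s \<partial>lborel)"
  proof (rule integral_mono)
    show "integrable lborel (\<lambda>s. k t0 s * ?e s - k t s * ?e s)"
      by (intro Bochner_Integration.integrable_diff kint)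
    show "integrable lborel (\<lambda>s. K * h powr a * indicator {t..t0} s
      - (1 - a) * h / (4 * t0) * c * indicator {t0/4..t0/2} s)"
      by (intro Bochner_Integration.integrable_diff integrable_mult_right integrable_real_indicator)
        (auto simp: emeasure_lborel_Icc_eq)
    fix s
    consider "s \<le> 0 \<or> s \<ge> t0" | "0 < s" "s < t" | "t \<le> s" "s < t0" "0 < s" using t by linarith
    then show "k t0 s * ?e s - k t s * ?e s \<le> K * h powr a * indicator {t..t0} s
      - (1 - a) * h / (4 * t0) * c * indicator {t0/4..t0/2} s"
    proof cases
      case 1
      then have "k t0 s * ?e s - k t s * ?e s = 0" using t by (auto simp: k_def)
      then show ?thesis using 1 t t0 K by (auto simp: indicator_def)
    next
      case 2
      have "(1 - a) * ((1 - s / t0) - (1 - s / t)) \<le> (1 - s / t) powr (a - 1) - (1 - s / t0) powr (a - 1)"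
        by (rule powr_neg_diff_ge) (use 2 t t0 a in \<open>auto simp: field_simps\<close>)
      then have kd: "(1 - a) * (s / t - s / t0) \<le> k t s - k t0 s"
        using 2 t t0 by (simp add: k_eq)
      have "s * h / t0\<^sup>2 \<le> s * h / (t * t0)"
        using 2 t t0 h by (intro divide_left_mono) (auto simp: power2_eq_square)
      also have "\<dots> = s / t - s / t0" using t t0 by (simp add: t_def field_simps)
      finally have "(1 - a) * (s * h / t0\<^sup>2) \<le> (1 - a) * (s / t - s / t0)"
        using a by (intro mult_left_mono) auto
      with kd have kd: "(1 - a) * (s * h / t0\<^sup>2) \<le> k t s - k t0 s" by linarith
      have es: "0 < ?e s" using 2 t epos by simp
      show ?thesis
      proof (cases "s \<in> {t0/4..t0/2}")
        case True
        have "t0 / 4 * h / t0\<^sup>2 \<le> s * h / t0\<^sup>2" using True h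
          by (intro divide_right_mono mult_right_mono) auto
        then have "(1 - a) * (t0 / 4 * h / t0\<^sup>2) \<le> (1 - a) * (s * h / t0\<^sup>2)"
          using a by (intro mult_left_mono) auto
        have "(1 - a) * h / (4 * t0) \<le> k t s - k t0 s"
        proof -
          have "(1 - a) * h / (4 * t0) = (1 - a) * (t0 / 4 * h / t0\<^sup>2)"
            using t0 by (simp add: power2_eq_square)
          also note \<open>(1 - a) * (t0 / 4 * h / t0\<^sup>2) \<le> (1 - a) * (s * h / t0\<^sup>2)\<close>
          also note kd
          finally show ?thesis .
        qed
        moreover have "0 \<le> (1 - a) * h / (4 * t0)" using a h t0 by simp
        ultimately have "(1 - a) * h / (4 * t0) * c \<le> (k t s - k t0 s) * ?e s"
          using s0(2)[OF True] c unfolding c_def by (intro mult_mono) linarith+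
        then show ?thesis using 2 True by (simp add: algebra_simps)
      next
        case False
        have "0 \<le> (1 - a) * (s * h / t0\<^sup>2)" using a 2 h by simp
        with kd have "0 \<le> (k t s - k t0 s) * ?e s" using es by (intro mult_nonneg_nonneg) auto
        then show ?thesis using 2 False by (simp add: algebra_simps)
      qed
    next
      case 3
      have "k t0 s = t0 powr (1 - a) * (t0 - s) powr (a - 1)"
        using 3 a by (simp add: k_def rl_kernel_def less_imp_neq[OF Gamma_real_pos, symmetric])
      then have "k t0 s * ?e s \<le> t0 powr (1 - a) * (t0 - s) powr (a - 1) * (L * (t0 - s))"
        using lip[of s] 3 t by (simp add: mult_left_mono)
      also have "\<dots> = K * (t0 - s) powr a"
        using 3 powr_add[of "t0 - s" "a - 1" 1] by (simp add: K_def)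
      also have "\<dots> \<le> K * h powr a"
        using 3 K a by (intro mult_left_mono powr_mono2) (auto simp: t_def)
      finally show ?thesis using 3 t by (simp add: k_def)
    qed
  qed
  also have "\<dots> = K * h powr a * h - (1 - a) * h / (4 * t0) * c * (t0 / 4)"
    using h t0 by (subst Bochner_Integration.integral_diff)
      (auto intro!: integrable_mult_right integrable_real_indicator simp: t_def emeasure_lborel_Icc_eq)
  also have "\<dots> = h * (K * h powr a - (1 - a) * c / 16)"
    using t0 by (simp add: field_simps)
  also have "\<dots> \<le> 0"
  proof -
    have "K * h powr a \<le> K * \<kappa>" using ha K by simp
    also have "\<dots> = (1 - a) * c / 16" using K by (simp add: \<kappa>_def)
    finally show ?thesis using h by (simp add: mult_nonneg_nonpos)
  qed
  finally show False by simp
qed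

text \<open>
  With positivity, both statements can be read off the Volterra equation, whose integral term is now
  nonnegative.
\<close>

lemma
  assumes a: "0 < a" "a < 1" and l: "0 < l"
  shows ml_kernel_le_rl_kernel: "ml_kernel a l t \<le> rl_kernel a t"
    and nn_integral_ml_kernel_conv:
      "(\<integral>\<^sup>+ s. ennreal (rl_kernel a (t - s) * ml_kernel a l s) \<partial>lborel)
        = ennreal ((rl_kernel a t - ml_kernel a l t) / l)"
proof -
  have nn: "0 \<le> rl_kernel a (t - s) * ml_kernel a l s" for s
    using ml_kernel_nonneg[OF a l] rl_kernel_nonneg a by simp
  have eq: "(\<integral> s. rl_kernel a (t - s) * ml_kernel a l s \<partial>lborel) = (rl_kernel a t - ml_kernel a l t) / l"
    using ml_kernel_volterra[OF a(1), of l t] l by (simp add: field_simps)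
  have "0 \<le> (rl_kernel a t - ml_kernel a l t) / l"
    unfolding eq[symmetric] using nn by (intro Bochner_Integration.integral_nonneg) auto
  then show "ml_kernel a l t \<le> rl_kernel a t" using l by (simp add: zero_le_divide_iff)
  show "(\<integral>\<^sup>+ s. ennreal (rl_kernel a (t - s) * ml_kernel a l s) \<partial>lborel)
        = ennreal ((rl_kernel a t - ml_kernel a l t) / l)"
    unfolding eq[symmetric] using nn
    by (intro nn_integral_eq_integral integrable_ml_kernel_conv a) auto
qed

section \<open>Causal convolutions\<close>

text \<open>
  Integration runs over the whole line: for kernels and functions that vanish on \<open>(- \<infinity>, 0]\<close> this
  is the causal convolution over \<open>(0, t)\<close>, and no integration bounds have to be moved in Fubini
  arguments.
\<close>

definition conv :: "(real \<Rightarrow> real) \<Rightarrow> (real \<Rightarrow> 'b::{banach,second_countable_topology}) \<Rightarrow> real \<Rightarrow> 'b" where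
  "conv k w t = (\<integral> s. k (t - s) *\<^sub>R w s \<partial>lborel)"

lemma conv_measurable [measurable]:
  assumes [measurable]: "k \<in> borel_measurable borel" "w \<in> borel_measurable borel"
  shows "conv k w \<in> borel_measurable borel"
  unfolding conv_def[abs_def] by measurable

text \<open>
  For nonnegative kernels, integrability with respect to the composed kernel \<open>h\<close> at the one point
  \<open>t\<close> already implies integrability on the product, by Tonelli. The inner convolution need not exist at
  every point.
\<close>

lemma conv_assoc:
  fixes w :: "real \<Rightarrow> 'b::{banach,second_countable_topology}"
  assumes [measurable]: "k \<in> borel_measurable borel" "l \<in> borel_measurable borel" "h \<in> borel_measurable borel"
      "w \<in> borel_measurable borel"
    and k: "\<And>\<tau>. 0 \<le> k \<tau>" and l: "\<And>\<tau>. 0 \<le> l \<tau>" and h: "\<And>\<tau>. 0 \<le> h \<tau>"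
    and kl: "\<And>\<tau>. (\<integral>\<^sup>+ s. ennreal (k (\<tau> - s) * l s) \<partial>lborel) = ennreal (h \<tau>)"
    and int: "integrable lborel (\<lambda>r. h (t - r) *\<^sub>R w r)"
  shows "conv k (conv l w) t = conv h w t"
proof -
  have shift: "(\<integral>\<^sup>+ s. ennreal (k (t - s) * l (s - r)) \<partial>lborel) = ennreal (h (t - r))" for r
  proof -
    have "(\<integral>\<^sup>+ s. ennreal (k (t - s) * l (s - r)) \<partial>lborel)
        = ennreal \<bar>1\<bar> * (\<integral>\<^sup>+ s. ennreal (k (t - (r + 1 * s)) * l ((r + 1 * s) - r)) \<partial>lborel)"
      by (rule nn_integral_real_affine) auto
    also have "\<dots> = ennreal (h (t - r))" using kl[of "t - r"] by (simp add: diff_diff_eq)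
    finally show ?thesis .
  qed
  have shiftb: "has_bochner_integral lborel (\<lambda>s. k (t - s) * l (s - r)) (h (t - r))" for r
    by (rule has_bochner_integral_nn_integral) (auto simp: k l h shift)
  let ?F = "\<lambda>r s. (k (t - s) * l (s - r)) *\<^sub>R w r"
  have F: "integrable (lborel \<Otimes>\<^sub>M lborel) (case_prod ?F)"
  proof (rule integrableI_bounded)
    show "case_prod ?F \<in> borel_measurable (lborel \<Otimes>\<^sub>M lborel)" by measurable
    have "(\<integral>\<^sup>+ z. ennreal (norm (case_prod ?F z)) \<partial>(lborel \<Otimes>\<^sub>M lborel))
        = (\<integral>\<^sup>+ r. \<integral>\<^sup>+ s. ennreal (norm (?F r s)) \<partial>lborel \<partial>lborel)"
      by (subst lborel.nn_integral_fst[symmetric]) (auto simp: case_prod_beta)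
    also have "\<dots> = (\<integral>\<^sup>+ r. ennreal (norm (h (t - r) *\<^sub>R w r)) \<partial>lborel)"
    proof (rule nn_integral_cong)
      fix r
      have "(\<integral>\<^sup>+ s. ennreal (norm (?F r s)) \<partial>lborel)
          = (\<integral>\<^sup>+ s. ennreal (k (t - s) * l (s - r)) * ennreal (norm (w r)) \<partial>lborel)"
        by (rule nn_integral_cong) (simp add: abs_mult k l ennreal_mult)
      also have "\<dots> = ennreal (h (t - r)) * ennreal (norm (w r))"
        by (subst nn_integral_multc) (auto simp: shift)
      finally show "(\<integral>\<^sup>+ s. ennreal (norm (?F r s)) \<partial>lborel) = ennreal (norm (h (t - r) *\<^sub>R w r))"
        by (simp add: h ennreal_mult)
    qed
    also have "\<dots> < \<infinity>" using int by (simp add: integrable_iff_bounded)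
    finally show "(\<integral>\<^sup>+ z. ennreal (norm (case_prod ?F z)) \<partial>(lborel \<Otimes>\<^sub>M lborel)) < \<infinity>" .
  qed
  have "conv k (conv l w) t = (\<integral> s. \<integral> r. ?F r s \<partial>lborel \<partial>lborel)"
    unfolding conv_def by (simp flip: integral_scaleR_right)
  also have "\<dots> = (\<integral> r. \<integral> s. ?F r s \<partial>lborel \<partial>lborel)"
    by (rule lborel_pair.Fubini_integral[OF F])
  also have "\<dots> = conv h w t"
    using shiftb by (simp add: conv_def has_bochner_integral_iff)
  finally show ?thesis .
qed

text \<open>
  A bound by two kernels covers every function that occurs below: one term for the source or for its
  deviation from the initial value, the other for the contribution of the operator.
\<close>

lemma
  fixes w :: "real \<Rightarrow> 'b::{banach,second_countable_topology}"
  assumes a: "0 < a" and b: "0 < b" "0 < c" and [measurable]: "k \<in> borel_measurable borel" "w \<in> borel_measurable borel"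
    and k: "\<And>\<tau>. \<bar>k \<tau>\<bar> \<le> rl_kernel a \<tau>"
    and w: "\<And>s. s < t \<Longrightarrow> norm (w s) \<le> B * rl_kernel b s + C * rl_kernel c s"
  shows conv_integrable_bound: "integrable lborel (\<lambda>s. k (t - s) *\<^sub>R w s)"
    and conv_norm_bound: "norm (conv k w t) \<le> B * rl_kernel (a + b) t + C * rl_kernel (a + c) t"
proof -
  let ?G = "\<lambda>s. B * (rl_kernel a (t - s) * rl_kernel b s) + C * (rl_kernel a (t - s) * rl_kernel c s)"
  have G: "integrable lborel ?G"
    by (intro Bochner_Integration.integrable_add integrable_mult_right integrable_rl_kernel_conv a b)
  have le: "norm (k (t - s) *\<^sub>R w s) \<le> ?G s" for s
  proof (cases "s < t")
    case True
    have "norm (k (t - s) *\<^sub>R w s) \<le> rl_kernel a (t - s) * (B * rl_kernel b s + C * rl_kernel c s)"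
      using k[of "t - s"] w[OF True] by (simp add: mult_mono rl_kernel_nonneg[OF a])
    then show ?thesis by (simp add: algebra_simps)
  next
    case False
    then show ?thesis using k[of "t - s"] by simp
  qed
  show "integrable lborel (\<lambda>s. k (t - s) *\<^sub>R w s)"
  proof (rule Bochner_Integration.integrable_bound[OF G])
    show "AE s in lborel. norm (k (t - s) *\<^sub>R w s) \<le> norm (?G s)"
      by (rule AE_I2) (use le in \<open>metis abs_ge_self order_trans real_norm_def\<close>)
  qed measurable
  have "norm (conv k w t) \<le> (\<integral> s. ?G s \<partial>lborel)"
  proof -
    have "norm (conv k w t) \<le> (\<integral> s. norm (k (t - s) *\<^sub>R w s) \<partial>lborel)"
      unfolding conv_def by (rule integral_norm_bound)
    also have "\<dots> \<le> (\<integral> s. ?G s \<partial>lborel)"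
      by (rule integral_mono[OF integrable_norm[OF \<open>integrable lborel (\<lambda>s. k (t - s) *\<^sub>R w s)\<close>] G le])
    finally show ?thesis .
  qed
  also have "\<dots> = B * rl_kernel (a + b) t + C * rl_kernel (a + c) t"
    by (subst Bochner_Integration.integral_add)
       (auto intro!: integrable_mult_right integrable_rl_kernel_conv a b simp: rl_kernel_conv a b)
  finally show "norm (conv k w t) \<le> B * rl_kernel (a + b) t + C * rl_kernel (a + c) t" .
qed

text \<open>
  Passage from Lebesgue to Borel measurable functions: \<open>w'\<close> is a Borel representative of \<open>w\<close> on
  \<open>(0, t)\<close>.
\<close>

lemma rl_integral_conv:
  fixes w w' :: "real \<Rightarrow> 'b::euclidean_space"
  assumes a: "a \<noteq> 0" and [measurable]: "w' \<in> borel_measurable borel"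
    and ae: "AE s in lebesgue. 0 < s \<longrightarrow> s < t \<longrightarrow> w' s = w s" and z: "\<And>s. s \<le> 0 \<Longrightarrow> w' s = 0"
  shows "rl_integral a w t = conv (rl_kernel a) w' t"
proof -
  let ?F = "\<lambda>s. rl_kernel a (t - s) *\<^sub>R w' s"
  let ?G = "\<lambda>s. (1 / Gamma a) *\<^sub>R (indicator {0<..<t} s *\<^sub>R ((t - s) powr (a - 1) *\<^sub>R w s))"
  have eq: "AE s in lebesgue. ?F s = ?G s"
    using ae
  proof eventually_elim
    case (elim s)
    then show ?case
      by (cases "0 < s \<and> s < t") (auto simp: rl_kernel_def z)
  qed
  have F: "?F \<in> borel_measurable lebesgue"
    by (rule measurable_completion) measurable
  have "conv (rl_kernel a) w' t = (\<integral> s. ?F s \<partial>lebesgue)"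
    unfolding conv_def by (rule integral_completion[symmetric]) measurable
  also have "\<dots> = (\<integral> s. ?G s \<partial>lebesgue)"
    by (rule integral_cong_AE[OF F borel_measurable_AE[OF F eq] eq])
  also have "\<dots> = (1 / Gamma a) *\<^sub>R (\<integral> s. indicator {0<..<t} s *\<^sub>R ((t - s) powr (a - 1) *\<^sub>R w s) \<partial>lebesgue)"
    by (rule integral_scaleR_right)
  finally show ?thesis using a by (simp add: rl_integral_def set_lebesgue_integral_def)
qed

section \<open>Injectivity of the fractional integral\<close>

lemma ex_borel_representative:
  fixes w :: "real \<Rightarrow> 'b::euclidean_space"
  assumes "w \<in> borel_measurable lebesgue"
  obtains w' where "w' \<in> borel_measurable borel" "AE s in lebesgue. w' s = w s"
proof -
  have "\<exists>g. g \<in> borel_measurable borel \<and> (AE s in lebesgue. w s \<bullet> b = g s)" for b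
  proof -
    have "(\<lambda>s. w s \<bullet> b) \<in> borel_measurable lebesgue" using assms by measurable
    from completion_ex_borel_measurable_real[OF this] show ?thesis
      by (auto intro: AE_completion)
  qed
  then obtain g where g: "\<And>b. g b \<in> borel_measurable borel" "\<And>b. AE s in lebesgue. w s \<bullet> b = g b s"
    by metis
  show thesis
  proof
    show "(\<lambda>s. \<Sum>b\<in>Basis. g b s *\<^sub>R b) \<in> borel_measurable borel" using g(1) by measurable
    have "AE s in lebesgue. \<forall>b\<in>Basis. w s \<bullet> b = g b s"
      by (rule AE_finite_allI) (use g in auto)
    then show "AE s in lebesgue. (\<Sum>b\<in>Basis. g b s *\<^sub>R b) = w s"
    proof eventually_elim
      case (elim s)
      then have "(\<Sum>b\<in>Basis. g b s *\<^sub>R b) = (\<Sum>b\<in>Basis. (w s \<bullet> b) *\<^sub>R b)" by (intro sum.cong) auto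
      then show ?case by (simp add: euclidean_representation)
    qed
  qed
qed

text \<open>
  The positive and the negative part of \<open>f\<close> are densities of finite measures that agree on all half
  lines, hence coincide.
\<close>

lemma zero_primitive_imp_AE_zero_real:
  fixes f :: "real \<Rightarrow> real"
  assumes int: "integrable lborel f"
    and z: "\<And>x. (\<integral> s. indicator {x<..} s * f s \<partial>lborel) = 0"
  shows "AE s in lborel. f s = 0"
proof -
  have [measurable]: "f \<in> borel_measurable borel" using int by auto
  let ?p = "\<lambda>s. max 0 (f s)" and ?n = "\<lambda>s. max 0 (- f s)"
  have p: "integrable lborel ?p" and n: "integrable lborel ?n" using int by auto
  have em: "emeasure (density lborel h) {x<..} = ennreal (\<integral> s. indicator {x<..} s * h s \<partial>lborel)"
    if h: "integrable lborel h" "\<And>s. 0 \<le> h s" for h :: "real \<Rightarrow> real" and x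
  proof -
    have [measurable]: "h \<in> borel_measurable borel" using h by auto
    have "emeasure (density lborel h) {x<..} = (\<integral>\<^sup>+ s. ennreal (indicator {x<..} s * h s) \<partial>lborel)"
      by (subst emeasure_density) (auto intro!: nn_integral_cong simp: indicator_def)
    also have "\<dots> = ennreal (\<integral> s. indicator {x<..} s * h s \<partial>lborel)"
      by (rule nn_integral_eq_integral)
        (use integrable_mult_indicator[OF _ h(1), of "{x<..}"] h in \<open>auto simp: real_scaleR_def\<close>)
    finally show ?thesis .
  qed
  have "density lborel ?p = density lborel ?n"
  proof (rule measure_eqI_lessThan)
    fix x
    have "(\<integral> s. indicator {x<..} s * ?p s \<partial>lborel) - (\<integral> s. indicator {x<..} s * ?n s \<partial>lborel)
        = (\<integral> s. indicator {x<..} s * ?p s - indicator {x<..} s * ?n s \<partial>lborel)"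
      using integrable_mult_indicator[OF _ p, of "{x<..}"] integrable_mult_indicator[OF _ n, of "{x<..}"]
      by (subst Bochner_Integration.integral_diff) auto
    also have "\<dots> = (\<integral> s. indicator {x<..} s * f s \<partial>lborel)"
      by (rule Bochner_Integration.integral_cong) (auto simp: indicator_def max_def)
    finally have "(\<integral> s. indicator {x<..} s * ?p s \<partial>lborel) = (\<integral> s. indicator {x<..} s * ?n s \<partial>lborel)"
      using z[of x] by simp
    then show "emeasure (density lborel ?p) {x<..} = emeasure (density lborel ?n) {x<..}"
      using em[OF p, of x] em[OF n, of x] by simp
    show "emeasure (density lborel ?p) {x<..} < \<infinity>"
      using em[OF p, of x] by simp
  qed auto
  then have "AE s in lborel. ennreal (?p s) = ennreal (?n s)"
    by (subst (asm) sigma_finite_measure.density_unique_iff[OF sigma_finite_lborel]) auto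
  then show ?thesis
  proof eventually_elim
    case (elim s)
    then show ?case by (auto simp: max_def split: if_splits)
  qed
qed

lemma zero_primitive_imp_AE_zero:
  fixes w :: "real \<Rightarrow> 'b::euclidean_space"
  assumes int: "integrable lborel w"
    and z: "\<And>t. 0 < t \<Longrightarrow> t \<le> T \<Longrightarrow> (\<integral> s. indicator {0<..<t} s *\<^sub>R w s \<partial>lborel) = 0"
  shows "AE s in lborel. 0 < s \<longrightarrow> s < T \<longrightarrow> w s = 0"
proof -
  have "AE s in lborel. indicator {0<..<T} s * (w s \<bullet> b) = 0" for b
  proof (rule zero_primitive_imp_AE_zero_real)
    have wb: "integrable lborel (\<lambda>s. w s \<bullet> b)" using int by simp
    then have ind: "integrable lborel (\<lambda>s. indicator {0<..<t} s * (w s \<bullet> b))" for t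
      using integrable_mult_indicator[OF _ wb, of "{0<..<t}"] by simp
    then show "integrable lborel (\<lambda>s. indicator {0<..<T} s * (w s \<bullet> b))" .
    have pr: "(\<integral> s. indicator {0<..<t} s * (w s \<bullet> b) \<partial>lborel) = 0" if "t \<le> T" for t
    proof (cases "0 < t")
      case True
      have "integrable lborel (\<lambda>s. indicator {0<..<t} s *\<^sub>R w s)"
        by (rule integrable_mult_indicator[OF _ int]) auto
      from integral_inner_left[OF this, of b] z[OF True that] show ?thesis by simp
    qed simp
    fix x
    have "(\<integral> s. indicator {x<..} s * (indicator {0<..<T} s * (w s \<bullet> b)) \<partial>lborel)
        = (\<integral> s. indicator {0<..<T} s * (w s \<bullet> b) - indicator {0<..<min x T} s * (w s \<bullet> b) \<partial>lborel)"
    proof (rule integral_cong_AE)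
      show "AE s in lborel. indicator {x<..} s * (indicator {0<..<T} s * (w s \<bullet> b))
          = indicator {0<..<T} s * (w s \<bullet> b) - indicator {0<..<min x T} s * (w s \<bullet> b)"
        using AE_lborel_singleton[of x] by eventually_elim (auto simp: indicator_def)
    qed (use wb in auto)
    also have "\<dots> = 0"
      by (subst Bochner_Integration.integral_diff[OF ind ind]) (simp add: pr)
    finally show "(\<integral> s. indicator {x<..} s * (indicator {0<..<T} s * (w s \<bullet> b)) \<partial>lborel) = 0" .
  qed
  then have "AE s in lborel. \<forall>b\<in>Basis. indicator {0<..<T} s * (w s \<bullet> b) = 0"
    by (intro AE_finite_allI) auto
  then show ?thesis
  proof eventually_elim
    case (elim s)
    show ?case
    proof (intro impI)
      assume "0 < s" "s < T"
      with elim have "\<forall>b\<in>Basis. w s \<bullet> b = 0" by simp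
      then show "w s = 0" by (simp only: euclidean_all_zero_iff)
    qed
  qed
qed

text \<open>
  Applying \<open>J\<^sup>1\<^sup>-\<^sup>g\<close> to \<open>J\<^sup>g w\<close> produces the primitive of \<open>w\<close>, at every point: the composed kernel is the
  bounded function \<open>rl_kernel 1\<close>, so that integrability of \<open>w\<close> suffices in \<open>conv_assoc\<close>.
\<close>

lemma frac_integral_injective:
  fixes v w :: "real \<Rightarrow> 'b::euclidean_space"
  assumes g: "0 < g" "g < 1"
    and w: "integrable lborel w" "\<And>s. s \<le> 0 \<Longrightarrow> w s = 0"
    and v: "integrable lborel v" "\<And>s. s \<le> 0 \<Longrightarrow> v s = 0"
    and ae: "AE t in lborel. 0 < t \<longrightarrow> t < T \<longrightarrow> conv (rl_kernel g) w t = conv (rl_kernel g) v t"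
  shows "AE s in lborel. 0 < s \<longrightarrow> s < T \<longrightarrow> w s = v s"
proof -
  have [measurable]: "w \<in> borel_measurable borel" "v \<in> borel_measurable borel" using w v by auto
  have ind: "integrable lborel (\<lambda>s. indicator {0<..<t} s *\<^sub>R u s)"
    if "integrable lborel u" for u :: "real \<Rightarrow> 'b" and t :: real
    by (rule integrable_mult_indicator[OF _ that]) auto
  have g': "0 < 1 - g" using g by simp
  have prim: "(\<integral> s. indicator {0<..<t} s *\<^sub>R u s \<partial>lborel) = conv (rl_kernel (1 - g)) (conv (rl_kernel g) u) t"
    if u: "integrable lborel u" "\<And>s. s \<le> 0 \<Longrightarrow> u s = 0" for u :: "real \<Rightarrow> 'b" and t
  proof -
    have eq: "rl_kernel 1 (t - s) *\<^sub>R u s = indicator {0<..<t} s *\<^sub>R u s" for s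
      using u(2)[of s] by (cases "0 < s") (auto simp: rl_kernel_1 indicator_def)
    have "conv (rl_kernel (1 - g)) (conv (rl_kernel g) u) t = conv (rl_kernel 1) u t"
      by (rule conv_assoc)
         (use nn_integral_rl_kernel_conv[OF g' g(1)] g u(1) ind[OF u(1)] in \<open>auto simp: rl_kernel_nonneg eq\<close>)
    also have "\<dots> = (\<integral> s. indicator {0<..<t} s *\<^sub>R u s \<partial>lborel)"
      by (simp only: conv_def eq)
    finally show ?thesis ..
  qed
  have "AE s in lborel. 0 < s \<longrightarrow> s < T \<longrightarrow> w s - v s = 0"
  proof (rule zero_primitive_imp_AE_zero)
    show "integrable lborel (\<lambda>s. w s - v s)" using w v by auto
    fix t assume t: "0 < t" "t \<le> T"
    have "conv (rl_kernel (1 - g)) (conv (rl_kernel g) w) t = conv (rl_kernel (1 - g)) (conv (rl_kernel g) v) t"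
      unfolding conv_def[of "rl_kernel (1 - g)"]
    proof (rule integral_cong_AE)
      have neg: "conv (rl_kernel g) u s = 0" if "s \<le> 0" "\<And>s. s \<le> 0 \<Longrightarrow> u s = 0" for s and u :: "real \<Rightarrow> 'b"
      proof -
        have "(\<lambda>r. rl_kernel g (s - r) *\<^sub>R u r) = (\<lambda>r. 0)"
        proof
          fix r show "rl_kernel g (s - r) *\<^sub>R u r = 0" using that(1) that(2)[of r] by (cases "r \<le> 0") auto
        qed
        then show ?thesis by (simp only: conv_def Bochner_Integration.integral_zero)
      qed
      show "AE s in lborel. rl_kernel (1 - g) (t - s) *\<^sub>R conv (rl_kernel g) w s
          = rl_kernel (1 - g) (t - s) *\<^sub>R conv (rl_kernel g) v s"
        using ae
      proof eventually_elim
        case (elim s)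
        consider "s \<le> 0" | "0 < s" "s < t" | "t \<le> s" by linarith
        then show ?case by cases (use elim neg[OF _ w(2)] neg[OF _ v(2)] t in auto)
      qed
    qed auto
    then have "(\<integral> s. indicator {0<..<t} s *\<^sub>R w s \<partial>lborel) = (\<integral> s. indicator {0<..<t} s *\<^sub>R v s \<partial>lborel)"
      by (simp only: prim[OF w] prim[OF v])
    then show "(\<integral> s. indicator {0<..<t} s *\<^sub>R (w s - v s) \<partial>lborel) = 0"
      using ind[OF w(1)] ind[OF v(1)] by (simp add: scaleR_diff_right)
  qed
  then show ?thesis by simp
qed

text \<open>
  One function \<open>w\<close> with \<open>J\<^sup>g w = h\<close> shows that the choice in the definition of the fractional
  derivative succeeds; by injectivity its outcome can differ from \<open>w\<close> on a null set only.
\<close>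

lemma frac_deriv_eqI:
  fixes w h :: "real \<Rightarrow> 'b::euclidean_space"
  assumes T: "0 < T" and g: "0 \<le> g" "g < 1" and w: "L2_fun T w"
    and eq: "AE t in lebesgue_on {0<..<T}. rl_integral g w t = h t"
  shows "L2_fun T (frac_deriv T g h)"
    and "AE t in lebesgue_on {0<..<T}. frac_deriv T g h t = w t"
proof -
  let ?v = "frac_deriv T g h"
  have "L2_fun T ?v \<and> (AE t in lebesgue_on {0<..<T}. rl_integral g ?v t = h t)"
    unfolding frac_deriv_def by (rule someI[of _ w]) (use w eq in blast)
  then have v: "L2_fun T ?v" "AE t in lebesgue_on {0<..<T}. rl_integral g ?v t = h t" by auto
  show "L2_fun T ?v" by (rule v)
  have repr: "\<exists>u'. u' \<in> borel_measurable borel \<and> integrable lborel u' \<and> (\<forall>s\<le>0. u' s = 0)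
      \<and> (AE s in lebesgue. 0 < s \<longrightarrow> s < T \<longrightarrow> u' s = u s)" if u: "L2_fun T u" for u :: "real \<Rightarrow> 'b"
  proof -
    have m: "(\<lambda>s. indicator {0<..<T} s *\<^sub>R u s) \<in> borel_measurable lebesgue"
      using u by (simp add: L2_fun_def borel_measurable_restrict_space_iff)
    obtain u1 where u1: "u1 \<in> borel_measurable borel" "AE s in lebesgue. u1 s = indicator {0<..<T} s *\<^sub>R u s"
      using ex_borel_representative[OF m] by blast
    let ?u = "\<lambda>s. indicator {0<..<T} s *\<^sub>R u1 s"
    have mu: "?u \<in> borel_measurable borel" using u1(1) by measurable
    have ae: "AE s in lebesgue. ?u s = indicator {0<..<T} s *\<^sub>R u s"
      using u1(2) by eventually_elim (auto simp: indicator_def)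
    have "integrable lebesgue (\<lambda>s. indicator {0<..<T} s *\<^sub>R (norm (u s))\<^sup>2)"
      using u by (simp add: L2_fun_def integrable_restrict_space)
    then have "integrable lebesgue (\<lambda>s. indicator {0<..<T} s + indicator {0<..<T} s *\<^sub>R (norm (u s))\<^sup>2)"
      by (intro Bochner_Integration.integrable_add integrable_real_indicator)
        (use T in \<open>auto simp: emeasure_lborel_Ioo\<close>)
    then have "integrable lebesgue ?u"
    proof (rule Bochner_Integration.integrable_bound)
      show "?u \<in> borel_measurable lebesgue" by (rule measurable_completion) (simp add: mu)
      show "AE s in lebesgue. norm (?u s) \<le> norm (indicator {0<..<T} s + indicator {0<..<T} s *\<^sub>R (norm (u s))\<^sup>2)"
        using ae
      proof eventually_elim
        case (elim s)
        have "norm (u s) \<le> 1 + (norm (u s))\<^sup>2"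
          using sum_squares_bound[of 1 "norm (u s)"] norm_ge_zero[of "u s"] by (simp del: norm_ge_zero)
        then show ?case unfolding elim by (auto simp: indicator_def)
      qed
    qed
    then have "integrable lborel ?u" using mu by (simp add: integrable_completion)
    moreover have "AE s in lebesgue. 0 < s \<longrightarrow> s < T \<longrightarrow> ?u s = u s"
      using ae by eventually_elim auto
    ultimately show ?thesis using mu by (intro exI[of _ ?u]) auto
  qed
  show "AE t in lebesgue_on {0<..<T}. ?v t = w t"
  proof (cases "g = 0")
    case True
    then show ?thesis using v(2) eq by (auto simp: rl_integral_def elim: eventually_elim2)
  next
    case False
    then have g0: "0 < g" using g by simp
    obtain v' where v': "v' \<in> borel_measurable borel" "integrable lborel v'" "\<And>s. s \<le> 0 \<Longrightarrow> v' s = 0"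
      "AE s in lebesgue. 0 < s \<longrightarrow> s < T \<longrightarrow> v' s = ?v s" using repr[OF v(1)] by blast
    obtain w' where w': "w' \<in> borel_measurable borel" "integrable lborel w'" "\<And>s. s \<le> 0 \<Longrightarrow> w' s = 0"
      "AE s in lebesgue. 0 < s \<longrightarrow> s < T \<longrightarrow> w' s = w s" using repr[OF w] by blast
    have rest: "(AE t in lebesgue_on {0<..<T}. Q t) \<longleftrightarrow> (AE t in lborel. 0 < t \<longrightarrow> t < T \<longrightarrow> Q t)" for Q
      by (simp add: AE_restrict_space_iff AE_completion_iff imp_conjL)
    have "AE t in lborel. 0 < t \<longrightarrow> t < T \<longrightarrow> v' t = w' t"
    proof (rule frac_integral_injective[OF g0 g(2) v'(2,3) w'(2,3)])
      have "AE t in lborel. 0 < t \<longrightarrow> t < T \<longrightarrow> rl_integral g ?v t = rl_integral g w t"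
        using v(2) eq unfolding rest by eventually_elim auto
      then show "AE t in lborel. 0 < t \<longrightarrow> t < T \<longrightarrow> conv (rl_kernel g) v' t = conv (rl_kernel g) w' t"
      proof eventually_elim
        case (elim t)
        show ?case
        proof (intro impI)
          assume t: "0 < t" "t < T"
          have "AE s in lebesgue. 0 < s \<longrightarrow> s < t \<longrightarrow> v' s = ?v s"
            using v'(4) by eventually_elim (use t in auto)
          then have 1: "rl_integral g ?v t = conv (rl_kernel g) v' t"
            by (rule rl_integral_conv[OF False v'(1) _ v'(3)])
          have "AE s in lebesgue. 0 < s \<longrightarrow> s < t \<longrightarrow> w' s = w s"
            using w'(4) by eventually_elim (use t in auto)
          then have 2: "rl_integral g w t = conv (rl_kernel g) w' t"
            by (rule rl_integral_conv[OF False w'(1) _ w'(3)])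
          show "conv (rl_kernel g) v' t = conv (rl_kernel g) w' t" using elim t 1 2 by simp
        qed
      qed
    qed
    moreover have "AE t in lborel. 0 < t \<longrightarrow> t < T \<longrightarrow> v' t = ?v t"
      "AE t in lborel. 0 < t \<longrightarrow> t < T \<longrightarrow> w' t = w t"
      using v'(4) w'(4) by (simp_all add: AE_completion_iff)
    ultimately show ?thesis unfolding rest by eventually_elim auto
  qed
qed

section \<open>Hilbert spaces over the scalar field and the spectral expansion\<close>

lemma orthogonal_summable:
  fixes x :: "nat \<Rightarrow> 'x::{real_inner,banach}"
  assumes orth: "\<And>i j. i \<noteq> j \<Longrightarrow> x i \<bullet> x j = 0" and sm: "summable (\<lambda>n. (norm (x n))\<^sup>2)"
  shows "summable x"
  unfolding summable_Cauchy
proof (intro allI impI)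
  fix e :: real assume e: "0 < e"
  then obtain N where N: "\<And>m n. N \<le> m \<Longrightarrow> norm (\<Sum>k\<in>{m..<n}. (norm (x k))\<^sup>2) < e\<^sup>2"
    using sm[unfolded summable_Cauchy, rule_format, of "e\<^sup>2"] by auto
  have "norm (sum x {m..<n}) < e" if "N \<le> m" for m n
  proof -
    have "(norm (sum x {m..<n}))\<^sup>2 = (\<Sum>k\<in>{m..<n}. (norm (x k))\<^sup>2)"
      by (rule norm_sum_Pythagorean) (auto simp: pairwise_def orthogonal_def orth)
    also have "\<dots> < e\<^sup>2" using N[OF that, of n] by simp
    finally show ?thesis using e by (simp add: power2_less_imp_less)
  qed
  then show "\<exists>N. \<forall>m\<ge>N. \<forall>n. norm (sum x {m..<n}) < e" by blast
qed

text \<open>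
  Imaginary scalars: comparing \<open>norm (1 + w) * norm (1 - w)\<close> with \<open>norm (1 - w * w)\<close> recovers
  \<open>w\<^sup>2 = - \<bar>w\<bar>\<^sup>2\<close>, as far as real parts are concerned, from multiplicativity of the norm.
\<close>

lemma inner_square_orthogonal_one:
  fixes w :: "'k::{real_normed_field,euclidean_space}"
  assumes w: "w \<bullet> 1 = 0"
  shows "(w * w) \<bullet> 1 = - (norm w)\<^sup>2"
proof -
  have one: "(1::'k) \<bullet> 1 = 1" using power2_norm_eq_inner[of "1::'k"] by simp
  have p: "(norm (1 + w))\<^sup>2 = 1 + (norm w)\<^sup>2" "(norm (1 - w))\<^sup>2 = 1 + (norm w)\<^sup>2"
    using w one by (simp_all add: power2_norm_eq_inner algebra_simps inner_commute)
  have "(1 + (norm w)\<^sup>2)\<^sup>2 = (norm ((1 + w) * (1 - w)))\<^sup>2"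
    unfolding norm_mult power_mult_distrib p by (simp add: power2_eq_square)
  also have "(1 + w) * (1 - w) = 1 - w * w" by (simp add: algebra_simps)
  also have "(norm (1 - w * w))\<^sup>2 = 1 - 2 * ((w * w) \<bullet> 1) + (norm (w * w))\<^sup>2"
    using one by (simp add: power2_norm_eq_inner algebra_simps inner_commute)
  finally show ?thesis by (simp add: norm_mult power2_eq_square algebra_simps)
qed

lemma
  fixes z :: "'k::{real_normed_field,euclidean_space}"
  shows inner_mult_scalar_cnj: "(z * scalar_cnj z) \<bullet> 1 = (norm z)\<^sup>2"
    and norm_scalar_cnj: "norm (scalar_cnj z) = norm z"
proof -
  define r w where "r = z \<bullet> 1" and "w = z - of_real r"
  have one: "(1::'k) \<bullet> 1 = 1" using power2_norm_eq_inner[of "1::'k"] by simp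
  have re: "of_real r \<bullet> (1::'k) = r" for r using one by (simp add: of_real_def)
  have w: "w \<bullet> 1 = 0" by (simp add: w_def r_def inner_diff_left re)
  have z: "z = of_real r + w" by (simp add: w_def)
  have c: "scalar_cnj z = of_real r - w" by (simp add: scalar_cnj_def w_def r_def)
  have ow: "of_real r \<bullet> w = 0" for r using w by (simp add: of_real_def inner_commute)
  have ow': "w \<bullet> of_real r = 0" for r using ow by (simp add: inner_commute)
  have oo: "of_real r \<bullet> (of_real r :: 'k) = r\<^sup>2" for r using one by (simp add: of_real_def power2_eq_square)
  have n1: "(norm z)\<^sup>2 = r\<^sup>2 + (norm w)\<^sup>2"
    unfolding z power2_norm_eq_inner by (simp add: inner_add_left inner_add_right ow ow' oo)
  have n2: "(norm (scalar_cnj z))\<^sup>2 = r\<^sup>2 + (norm w)\<^sup>2"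
    unfolding c power2_norm_eq_inner by (simp add: inner_diff_left inner_diff_right ow ow' oo)
  show "norm (scalar_cnj z) = norm z"
    by (rule power2_eq_imp_eq) (simp_all add: n1 n2)
  have "z * scalar_cnj z = of_real (r * r) - w * w"
    unfolding c by (subst z) (simp add: algebra_simps)
  then show "(z * scalar_cnj z) \<bullet> 1 = (norm z)\<^sup>2"
    using inner_square_orthogonal_one[OF w]
    by (simp only: inner_diff_left re n1) (simp add: power2_eq_square)
qed

lemma scalar_cnj_add: "scalar_cnj (x + y) = scalar_cnj x + scalar_cnj y"
  by (simp add: scalar_cnj_def inner_add_left algebra_simps)

lemma scalar_cnj_scaleR: "scalar_cnj (r *\<^sub>R x) = r *\<^sub>R scalar_cnj x"
  by (simp add: scalar_cnj_def scaleR_right_diff_distrib scaleR_conv_of_real[of r "of_real _"]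
      flip: of_real_mult)

context separable_hilbert_over
begin

lemma ip_scaleR_left: "ip (r *\<^sub>R x) z = r *\<^sub>R ip x z"
  using ip_scl_left[of "of_real r" x z] by (simp add: scl_of_real scaleR_conv_of_real)

lemma ip_add_right: "ip x (y + z) = ip x y + ip x z"
  using ip_cnj[of "y + z" x] ip_cnj[of y x] ip_cnj[of z x]
  by (metis ip_add_left ip_cnj scalar_cnj_add)

lemma ip_scaleR_right: "ip x (r *\<^sub>R z) = r *\<^sub>R ip x z"
  by (metis ip_cnj ip_scaleR_left scalar_cnj_scaleR)

lemma ip_minus_left: "ip (- x) z = - ip x z"
  using ip_scaleR_left[of "-1" x z] by simp

lemma ip_minus_right: "ip x (- z) = - ip x z"
  using ip_scaleR_right[of x "-1" z] by simp

lemma ip_diff_left: "ip (x - y) z = ip x z - ip y z"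
  using ip_add_left[of x "- y" z] by (simp add: ip_minus_left)

lemma ip_zero_swap: "ip x y = 0 \<Longrightarrow> ip y x = 0"
  by (subst ip_cnj) (simp add: scalar_cnj_def)

lemma ip_self: "ip x x = of_real ((norm x)\<^sup>2)"
proof -
  have "ip x x = of_real (2 * (ip x x \<bullet> 1)) - ip x x"
    by (subst ip_cnj) (simp add: scalar_cnj_def)
  then have "2 *\<^sub>R ip x x = 2 *\<^sub>R of_real (ip x x \<bullet> 1)"
    by (simp add: scaleR_conv_of_real algebra_simps)
  then show ?thesis by (simp add: ip_real_part power2_norm_eq_inner)
qed

lemma norm_scl: "norm (scl c x) = norm c * norm x"
proof -
  have "(norm (scl c x))\<^sup>2 = ip (scl c x) (scl c x) \<bullet> 1"
    by (simp add: ip_real_part power2_norm_eq_inner)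
  also have "ip (scl c x) (scl c x) = c * scalar_cnj (c * ip x x)"
    by (subst ip_scl_left, subst ip_cnj, subst ip_scl_left) simp
  also have "c * ip x x = (norm x)\<^sup>2 *\<^sub>R c"
    by (simp only: ip_self scaleR_conv_of_real mult.commute)
  also have "(c * scalar_cnj ((norm x)\<^sup>2 *\<^sub>R c)) \<bullet> 1 = (norm x)\<^sup>2 * ((c * scalar_cnj c) \<bullet> 1)"
    by (simp add: scalar_cnj_scaleR)
  also have "\<dots> = (norm c * norm x)\<^sup>2"
    by (simp add: inner_mult_scalar_cnj power_mult_distrib)
  finally show ?thesis by (simp add: power2_eq_iff_nonneg)
qed

text \<open>
  The Cauchy-Schwarz inequality of the real inner product, applied after rotating \<open>x\<close> by a scalar
  that makes \<open>ip x y\<close> real.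
\<close>

lemma norm_ip_le: "norm (ip x y) \<le> norm x * norm y"
proof -
  let ?z = "ip x y"
  have "(norm ?z)\<^sup>2 = ip (scl (scalar_cnj ?z) x) y \<bullet> 1"
    by (simp add: ip_scl_left inner_mult_scalar_cnj mult.commute[of _ ?z])
  also have "\<dots> \<le> norm (scl (scalar_cnj ?z) x) * norm y"
    by (simp only: ip_real_part norm_cauchy_schwarz)
  also have "\<dots> = norm ?z * (norm x * norm y)"
    by (simp add: norm_scl norm_scalar_cnj)
  finally show ?thesis by (cases "?z = 0") (simp_all add: power2_eq_square)
qed

lemma bounded_linear_ip_left: "bounded_linear (\<lambda>x. ip x y)"
  by (rule bounded_linear_intro[of _ "norm y"]) (auto simp: ip_add_left ip_scaleR_left norm_ip_le)

lemma bounded_linear_scl_left: "bounded_linear (\<lambda>c. scl c x)"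
proof (rule bounded_linear_intro[of _ "norm x"])
  show "scl (r *\<^sub>R c) x = r *\<^sub>R scl c x" for r c
    by (metis scale_scale scaleR_conv_of_real scl_of_real)
qed (auto simp: scale_left_distrib norm_scl)

end

context spectral_operator
begin

lemma lam_pos: "0 < lam n"
  using negative(1) lam_strict_mono strict_mono_less_eq[OF lam_strict_mono, of 0 n] by simp

lemma graph_iff: "x \<in> D \<and> y = - A x \<longleftrightarrow> (\<lambda>n. lam n *\<^sub>R P n x) sums y"
  using expansion unfolding operator_graph_def by (auto simp: set_eq_iff)

lemma A_symmetric: "x \<in> D \<Longrightarrow> y \<in> D \<Longrightarrow> ip (A x) y = ip x (A y)"
  using self_adjoint unfolding self_adjoint_on_def adjoint_graph_def operator_graph_def by blast

lemma P_in: "P n x \<in> D" "- A (P n x) = lam n *\<^sub>R P n x"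
  using P_projection[of n] unfolding is_orthogonal_projection_def by auto

lemma ip_residual: "y \<in> D \<Longrightarrow> - A y = lam n *\<^sub>R y \<Longrightarrow> ip (x - P n x) y = 0"
  using P_projection[of n] unfolding is_orthogonal_projection_def by auto

lemma eigenspaces_orthogonal:
  assumes "x \<in> D" "- A x = lam n *\<^sub>R x" "y \<in> D" "- A y = lam m *\<^sub>R y" "n \<noteq> m"
  shows "ip x y = 0"
proof -
  have "lam n *\<^sub>R ip x y = ip (- A x) y" using assms by (simp add: ip_scaleR_left)
  also have "\<dots> = ip x (- A y)" using A_symmetric[of x y] assms(1,3) by (simp add: ip_minus_left ip_minus_right)
  also have "\<dots> = lam m *\<^sub>R ip x y" using assms by (simp add: ip_scaleR_right)
  finally have "(lam n - lam m) *\<^sub>R ip x y = 0" by (simp add: scaleR_diff_left)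
  moreover have "lam n \<noteq> lam m" using \<open>n \<noteq> m\<close> strict_mono_eq[OF lam_strict_mono] by simp
  ultimately show ?thesis by simp
qed

lemma P_orthogonal: "n \<noteq> m \<Longrightarrow> ip (P n x) (P m y) = 0"
  by (rule eigenspaces_orthogonal[OF P_in P_in])

lemma inner_eq_0I: "ip x y = 0 \<Longrightarrow> x \<bullet> y = 0"
  by (simp flip: ip_real_part)

text \<open>
  Bessel's inequality.
\<close>

lemma summable_norm_P: "summable (\<lambda>n. (norm (P n x))\<^sup>2)"
proof (rule summableI_nonneg_bounded)
  fix N
  let ?s = "\<Sum>n<N. P n x"
  have Pn: "(norm ?s)\<^sup>2 = (\<Sum>n<N. (norm (P n x))\<^sup>2)"
    by (rule norm_sum_Pythagorean)
      (auto simp: pairwise_def orthogonal_def intro: inner_eq_0I P_orthogonal)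
  have "x \<bullet> P n x = (norm (P n x))\<^sup>2" for n
    using inner_eq_0I[OF ip_residual[OF P_in, of x n]]
    by (simp add: inner_diff_left power2_norm_eq_inner)
  then have "x \<bullet> ?s = (\<Sum>n<N. (norm (P n x))\<^sup>2)" by (simp add: inner_sum_right)
  then have "(norm (x - ?s))\<^sup>2 = (norm x)\<^sup>2 - (\<Sum>n<N. (norm (P n x))\<^sup>2)"
    using Pn by (simp add: power2_norm_eq_inner inner_diff_left inner_diff_right inner_commute)
  then show "(\<Sum>n<N. (norm (P n x))\<^sup>2) \<le> (norm x)\<^sup>2"
    using zero_le_power2[of "norm (x - ?s)"] by linarith
qed simp

text \<open>
  The remainder \<open>r = x - (\<Sum>n. P n x)\<close> has \<open>P m r = 0\<close> for all \<open>m\<close>. The expansion of the operator,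
  read as a description of its domain, then says that \<open>r\<close> belongs to the domain and that \<open>A r = 0\<close>;
  coercivity gives \<open>r = 0\<close>.
\<close>

lemma P_sums: "(\<lambda>n. P n x) sums x"
proof -
  have sm: "summable (\<lambda>n. P n x)"
    by (rule orthogonal_summable[OF _ summable_norm_P]) (auto intro: inner_eq_0I P_orthogonal)
  define r where "r = x - (\<Sum>n. P n x)"
  have "P m r = 0" for m
  proof -
    let ?y = "P m r"
    have "(\<lambda>n. ip (P n x) ?y) sums ip (\<Sum>n. P n x) ?y"
      by (rule bounded_linear.sums[OF bounded_linear_ip_left summable_sums[OF sm]])
    moreover have "(\<lambda>n. ip (P n x) ?y) sums ip (P m x) ?y"
    proof -
      have "(\<lambda>n. ip (P n x) ?y) sums (\<Sum>n\<in>{m}. ip (P n x) ?y)"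
        by (rule sums_finite) (auto intro: P_orthogonal)
      then show ?thesis by simp
    qed
    ultimately have "ip (\<Sum>n. P n x) ?y = ip (P m x) ?y" by (rule sums_unique2)
    then have "ip r ?y = ip (x - P m x) ?y" by (simp add: r_def ip_diff_left)
    also have "\<dots> = 0" by (rule ip_residual[OF P_in])
    finally have "ip r ?y = 0" .
    moreover have "ip (r - ?y) ?y = 0" by (rule ip_residual[OF P_in])
    ultimately have "ip ?y ?y = 0" by (simp add: ip_diff_left)
    then show ?thesis by (simp add: ip_self)
  qed
  then have "r \<in> D \<and> 0 = - A r" unfolding graph_iff by simp
  then have "lam 0 * (norm r)\<^sup>2 \<le> 0"
    using negative(2)[of r] ip_scaleR_left[of 0 0 r] by simp
  then have "r = 0" using lam_pos[of 0] by (simp add: mult_le_0_iff)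
  then show ?thesis using summable_sums[OF sm] by (simp add: r_def)
qed

text \<open>
  The partial sums of the orthogonal series \<open>\<Sum>n. lam n P n x = - A x\<close> are bounded in norm.
\<close>

lemma summable_norm_lam_P:
  assumes "x \<in> D" shows "summable (\<lambda>n. (norm (lam n *\<^sub>R P n x))\<^sup>2)"
proof -
  have s: "(\<lambda>n. lam n *\<^sub>R P n x) sums (- A x)" using graph_iff[of x "- A x"] assms by simp
  then obtain K where K: "\<And>N. norm (\<Sum>n<N. lam n *\<^sub>R P n x) \<le> K"
    using convergent_imp_Bseq[OF convergentI, OF s[unfolded sums_def]] unfolding Bseq_def by blast
  show ?thesis
  proof (rule summableI_nonneg_bounded)
    fix N
    have "(\<Sum>n<N. (norm (lam n *\<^sub>R P n x))\<^sup>2) = (norm (\<Sum>n<N. lam n *\<^sub>R P n x))\<^sup>2"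
      by (rule norm_sum_Pythagorean[symmetric])
        (auto simp: pairwise_def orthogonal_def intro: inner_eq_0I P_orthogonal)
    also have "\<dots> \<le> K\<^sup>2" by (rule power_mono[OF K]) simp
    finally show "(\<Sum>n<N. (norm (lam n *\<^sub>R P n x))\<^sup>2) \<le> K\<^sup>2" .
  qed simp
qed

text \<open>
  This is where the regularity of \<open>\<psi>\<close> enters: the eigenvalue is absorbed into \<open>P n \<psi>\<close>, and
  \<open>2 a b \<le> a\<^sup>2 + b\<^sup>2\<close> leaves two convergent series.
\<close>

lemma summable_lam_ip:
  assumes \<psi>: "\<psi> \<in> D"
  shows "summable (\<lambda>n. lam n * norm (ip (P n f) \<psi>))"
proof (rule summable_comparison_test')
  show "summable (\<lambda>n. (norm (P n f))\<^sup>2 + (norm (lam n *\<^sub>R P n \<psi>))\<^sup>2)"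
    by (intro summable_add summable_norm_P summable_norm_lam_P \<psi>)
  fix n :: nat
  have "ip (\<psi> - P n \<psi>) (P n f) = 0" by (rule ip_residual[OF P_in])
  then have "ip (P n f) (\<psi> - P n \<psi>) = 0" by (rule ip_zero_swap)
  then have "ip (P n f) \<psi> = ip (P n f) (P n \<psi>)"
    using ip_add_right[of "P n f" "\<psi> - P n \<psi>" "P n \<psi>"] by simp
  then have "norm (ip (P n f) \<psi>) \<le> norm (P n f) * norm (P n \<psi>)" by (simp add: norm_ip_le)
  then have "lam n * norm (ip (P n f) \<psi>) \<le> lam n * (norm (P n f) * norm (P n \<psi>))"
    using lam_pos[of n] by (intro mult_left_mono) auto
  also have "\<dots> = norm (P n f) * norm (lam n *\<^sub>R P n \<psi>)" using lam_pos[of n] by simp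
  also have "\<dots> \<le> (norm (P n f))\<^sup>2 + (norm (lam n *\<^sub>R P n \<psi>))\<^sup>2"
    using sum_squares_bound[of "norm (P n f)" "norm (lam n *\<^sub>R P n \<psi>)"]
      mult_nonneg_nonneg[OF norm_ge_zero[of "P n f"] norm_ge_zero[of "lam n *\<^sub>R P n \<psi>"]] by linarith
  finally show "norm (lam n * norm (ip (P n f) \<psi>)) \<le> (norm (P n f))\<^sup>2 + (norm (lam n *\<^sub>R P n \<psi>))\<^sup>2"
    using lam_pos[of n] by simp
qed

lemma ip_P_sums: "(\<lambda>n. ip (P n f) \<psi>) sums ip f \<psi>"
  by (rule bounded_linear.sums[OF bounded_linear_ip_left P_sums])

lemma ip_suminf_scl_P:
  assumes B: "\<And>n. norm (y n) \<le> B"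
  shows "(\<lambda>n. y n * ip (P n f) \<psi>) sums ip (\<Sum>n. scl (y n) (P n f)) \<psi>"
proof -
  have sm: "summable (\<lambda>n. scl (y n) (P n f))"
  proof (rule orthogonal_summable)
    fix i j :: nat assume ij: "i \<noteq> j"
    have "ip (scl (y j) (P j f)) (P i f) = 0" using ij by (simp add: ip_scl_left P_orthogonal)
    then have "ip (P i f) (scl (y j) (P j f)) = 0" by (rule ip_zero_swap)
    then have "ip (scl (y i) (P i f)) (scl (y j) (P j f)) = 0" by (simp add: ip_scl_left)
    then show "scl (y i) (P i f) \<bullet> scl (y j) (P j f) = 0" by (rule inner_eq_0I)
  next
    show "summable (\<lambda>n. (norm (scl (y n) (P n f)))\<^sup>2)"
    proof (rule summable_comparison_test')
      show "summable (\<lambda>n. B\<^sup>2 * (norm (P n f))\<^sup>2)" by (intro summable_mult summable_norm_P)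
      show "norm ((norm (scl (y n) (P n f)))\<^sup>2) \<le> B\<^sup>2 * (norm (P n f))\<^sup>2" for n
        using power_mono[OF B[of n] norm_ge_zero, of 2]
        by (simp add: norm_scl power_mult_distrib mult_right_mono)
    qed
  qed
  show "(\<lambda>n. y n * ip (P n f) \<psi>) sums ip (\<Sum>n. scl (y n) (P n f)) \<psi>"
    using bounded_linear.sums[OF bounded_linear_ip_left summable_sums[OF sm], of \<psi>]
    by (simp add: ip_scl_left)
qed

end

section \<open>The observation as a fractional integral\<close>

text \<open>
  Extension by zero from \<open>(0, T)\<close> turns a function that is continuous on \<open>[0, T]\<close> only into a Borel
  function on the line, as convolution requires.
\<close>

definition truncate :: "real \<Rightarrow> (real \<Rightarrow> 'k::real_normed_vector) \<Rightarrow> real \<Rightarrow> 'k" where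
  "truncate T p s = indicator {0<..<T} s *\<^sub>R p s"

lemma truncate_measurable [measurable]:
  fixes p :: "real \<Rightarrow> 'k::euclidean_space"
  assumes "continuous_on {0..T} p"
  shows "truncate T p \<in> borel_measurable borel"
proof -
  have "(\<lambda>s. indicator {0<..<T} s *\<^sub>R p s) \<in> borel_measurable borel"
    by (rule borel_measurable_continuous_on_indicator) (auto intro: continuous_on_subset[OF assms])
  then show ?thesis unfolding truncate_def[abs_def] .
qed

lemma admissible_sources_bounds:
  fixes p :: "real \<Rightarrow> 'k::{real_normed_field,euclidean_space}"
  assumes T: "0 < T" and p: "p \<in> admissible_sources T p0 M"
  shows "continuous_on {0..T} p" "0 \<le> M" "\<And>s. s \<in> {0..T} \<Longrightarrow> norm (p s) \<le> M"
    "\<And>s. s \<in> {0..T} \<Longrightarrow> norm (p s - p0) \<le> M * s"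
proof -
  obtain p' where c': "continuous_on {0..T} p'"
    and d: "\<And>t. t \<in> {0..T} \<Longrightarrow> (p has_vector_derivative p' t) (at t within {0..T})"
    using p unfolding admissible_sources_def C1_fun_def by auto
  have p0: "p 0 = p0" and nM: "C1_norm T p \<le> M" using p by (auto simp: admissible_sources_def)
  show c: "continuous_on {0..T} p"
    unfolding continuous_on_eq_continuous_within using d has_vector_derivative_continuous by blast
  have vd: "vector_derivative p (at t within {0..T}) = p' t" if "t \<in> {0..T}" for t
    using vector_derivative_within_cbox[of 0 T t p "p' t"] T that d[OF that] by auto
  have bdd: "bdd_above ((\<lambda>t. norm (u t)) ` {0..T})" if "continuous_on {0..T} u" for u :: "real \<Rightarrow> 'k"
    using compact_continuous_image[OF continuous_on_norm[OF that] compact_Icc]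
    by (intro bounded_imp_bdd_above compact_imp_bounded)
  let ?A = "SUP t\<in>{0..T}. norm (p t)" and ?B = "SUP t\<in>{0..T}. norm (p' t)"
  have A: "norm (p t) \<le> ?A" if "t \<in> {0..T}" for t by (rule cSUP_upper[OF that bdd[OF c]])
  have B: "norm (p' t) \<le> ?B" if "t \<in> {0..T}" for t by (rule cSUP_upper[OF that bdd[OF c']])
  have "(SUP t\<in>{0..T}. norm (vector_derivative p (at t within {0..T}))) = ?B"
    by (intro arg_cong[where f=Sup] image_cong) (simp_all add: vd)
  then have AB: "?A + ?B \<le> M" using nM by (simp add: C1_norm_def)
  have A0: "0 \<le> ?A" "0 \<le> ?B" 
    using order_trans[OF norm_ge_zero A[of 0]] order_trans[OF norm_ge_zero B[of 0]] T by auto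
  show "0 \<le> M" using A0 AB by simp
  show "norm (p s) \<le> M" if "s \<in> {0..T}" for s using A[OF that] A0 AB by linarith
  show "norm (p s - p0) \<le> M * s" if s: "s \<in> {0..T}" for s
  proof -
    have "norm (p s - p 0) \<le> M * norm (s - 0)"
    proof (rule differentiable_bound[where S="{0..T}" and f'="\<lambda>t h. h *\<^sub>R p' t"])
      show "(p has_derivative (\<lambda>h. h *\<^sub>R p' t)) (at t within {0..T})" if "t \<in> {0..T}" for t
        using d[OF that] by (simp add: has_vector_derivative_def)
      show "onorm (\<lambda>h. h *\<^sub>R p' t) \<le> M" if "t \<in> {0..T}" for t
      proof (rule onorm_bound)
        show "norm (h *\<^sub>R p' t) \<le> M * norm h" for h
          using mult_left_mono[of "norm (p' t)" M "\<bar>h\<bar>"] B[OF that] A0 AB by (simp add: mult.commute)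
      qed fact
    qed (use s T in auto)
    then show ?thesis using s p0 by simp
  qed
qed

text \<open>
  One Fourier mode of the evolution equation: convolution of a bounded scalar source with a
  Mittag-Leffler kernel.
\<close>

locale scalar_source =
  fixes T a M :: real and p :: "real \<Rightarrow> 'k::{real_normed_field,euclidean_space}"
  assumes T: "0 < T" and a: "0 < a" "a < 1" and cont: "continuous_on {0..T} p"
    and M: "0 \<le> M" and bound: "\<And>s. s \<in> {0..T} \<Longrightarrow> norm (p s) \<le> M"
begin

lemma truncate_source_measurable [measurable]: "truncate T p \<in> borel_measurable borel"
  by (rule truncate_measurable[OF cont])

lemma norm_truncate_source: "norm (truncate T p s) \<le> M * rl_kernel 1 s"
  using bound[of s] M by (auto simp: truncate_def rl_kernel_1 indicator_def)

definition mode :: "real \<Rightarrow> real \<Rightarrow> 'k" where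
  "mode l = conv (ml_kernel a l) (truncate T p)"

lemma [measurable]: "ml_kernel a l \<in> borel_measurable borel"
  by (rule ml_kernel_measurable[OF a(1)])

lemma mode_measurable [measurable]: "mode l \<in> borel_measurable borel"
  unfolding mode_def by measurable

lemma ml_kernel_abs_le: "0 < l \<Longrightarrow> \<bar>ml_kernel a l \<tau>\<bar> \<le> rl_kernel a \<tau>"
  using ml_kernel_nonneg[OF a, of l \<tau>] ml_kernel_le_rl_kernel[OF a, of l \<tau>] by simp

lemma norm_mode: "0 < l \<Longrightarrow> norm (mode l t) \<le> M * rl_kernel (a + 1) t"
proof -
  assume l: "0 < l"
  have "norm (mode l t) \<le> M * rl_kernel (a + 1) t + 0 * rl_kernel (a + 1) t"
    unfolding mode_def by (rule conv_norm_bound) (use a norm_truncate_source ml_kernel_abs_le[OF l] in auto)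
  then show ?thesis by simp
qed

text \<open>
  The Volterra equation of the kernel, convolved with the source.
\<close>

lemma mode_eq:
  assumes l: "0 < l"
  shows "mode l t = conv (rl_kernel a) (truncate T p) t - l *\<^sub>R conv (rl_kernel a) (mode l) t"
proof -
  let ?h = "\<lambda>\<tau>. (rl_kernel a \<tau> - ml_kernel a l \<tau>) / l"
  have ir: "integrable lborel (\<lambda>s. rl_kernel a (t - s) *\<^sub>R truncate T p s)"
    by (rule conv_integrable_bound[where b=1 and c=1 and B=M and C=0])
       (use a norm_truncate_source in \<open>auto simp: rl_kernel_nonneg\<close>)
  have im: "integrable lborel (\<lambda>s. ml_kernel a l (t - s) *\<^sub>R truncate T p s)"
    by (rule conv_integrable_bound[where a=a and b=1 and c=1 and B=M and C=0])
       (use a norm_truncate_source ml_kernel_abs_le[OF l] in auto)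
  have eq: "?h (t - s) *\<^sub>R truncate T p s
      = (1 / l) *\<^sub>R (rl_kernel a (t - s) *\<^sub>R truncate T p s - ml_kernel a l (t - s) *\<^sub>R truncate T p s)" for s
    by (simp add: scaleR_diff_left[symmetric])
  have "conv (rl_kernel a) (mode l) t = conv ?h (truncate T p) t"
    unfolding mode_def
  proof (rule conv_assoc)
    show "integrable lborel (\<lambda>r. ?h (t - r) *\<^sub>R truncate T p r)"
      unfolding eq using ir im by (intro integrable_scaleR_right Bochner_Integration.integrable_diff)
  qed (use a l ml_kernel_nonneg[OF a l] ml_kernel_le_rl_kernel[OF a l] nn_integral_ml_kernel_conv[OF a l]
       in \<open>auto simp: rl_kernel_nonneg\<close>)
  also have "\<dots> = (1 / l) *\<^sub>R (conv (rl_kernel a) (truncate T p) t - mode l t)"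
    unfolding conv_def[of ?h] eq integral_scaleR_right
    by (subst Bochner_Integration.integral_diff[OF ir im]) (simp add: mode_def conv_def)
  finally show ?thesis using l by simp
qed

end

text \<open>
  The sequence \<open>c n\<close> stands for \<open>ip (P n f) \<psi>\<close>. In terms of the solution \<open>u\<close>, the function
  \<open>feedback\<close> is \<open>ip u (- A \<psi>)\<close>, and \<open>forcing\<close> is, on \<open>(0, T)\<close>, the right-hand side
  \<open>A u + p f\<close> of the evolution equation paired with \<open>\<psi>\<close>.
\<close>

locale scalar_observation = scalar_source T a M p
  for T a M :: real and p :: "real \<Rightarrow> 'k::{real_normed_field,euclidean_space}" +
  fixes lam :: "nat \<Rightarrow> real" and c :: "nat \<Rightarrow> 'k" and c0 :: 'k
  assumes lam: "\<And>n. 0 < lam n" and sm: "summable (\<lambda>n. lam n * norm (c n))" and c0: "c sums c0"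
begin

definition weight :: real where "weight = (\<Sum>n. lam n * norm (c n))"

definition feedback :: "real \<Rightarrow> 'k" where
  "feedback t = (\<Sum>n. lam n *\<^sub>R (mode (lam n) t * c n))"

lemma weight_nonneg: "0 \<le> weight"
  unfolding weight_def using lam by (intro suminf_nonneg sm mult_nonneg_nonneg) (auto intro: less_imp_le)

lemma feedback_term_bound: "norm (lam n *\<^sub>R (mode (lam n) t * c n)) \<le> lam n * norm (c n) * (M * rl_kernel (a + 1) t)"
proof -
  have "norm (mode (lam n) t) * norm (c n) \<le> (M * rl_kernel (a + 1) t) * norm (c n)"
    by (intro mult_right_mono norm_mode lam) simp
  then have "lam n * (norm (mode (lam n) t) * norm (c n)) \<le> lam n * ((M * rl_kernel (a + 1) t) * norm (c n))"
    using lam[of n] by (intro mult_left_mono) auto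
  then show ?thesis using lam[of n] by (simp add: norm_mult mult_ac)
qed

lemma summable_feedback: "summable (\<lambda>n. norm (lam n *\<^sub>R (mode (lam n) t * c n)))"
proof (rule summable_comparison_test')
  show "summable (\<lambda>n. lam n * norm (c n) * (M * rl_kernel (a + 1) t))"
    by (rule summable_mult2[OF sm])
  show "norm (norm (lam n *\<^sub>R (mode (lam n) t * c n))) \<le> lam n * norm (c n) * (M * rl_kernel (a + 1) t)" for n
    using feedback_term_bound[of n t] by simp
qed

lemma feedback_measurable [measurable]: "feedback \<in> borel_measurable borel"
  unfolding feedback_def[abs_def] by measurable

lemma norm_feedback: "norm (feedback t) \<le> weight * M * rl_kernel (a + 1) t"
proof -
  have "norm (feedback t) \<le> (\<Sum>n. norm (lam n *\<^sub>R (mode (lam n) t * c n)))"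
    unfolding feedback_def by (rule summable_norm[OF summable_feedback])
  also have "\<dots> \<le> (\<Sum>n. lam n * norm (c n) * (M * rl_kernel (a + 1) t))"
    by (intro suminf_le feedback_term_bound summable_feedback summable_mult2 sm)
  also have "\<dots> = weight * M * rl_kernel (a + 1) t"
    using suminf_mult2[OF sm, of "M * rl_kernel (a + 1) t"] by (simp add: weight_def mult.assoc)
  finally show ?thesis .
qed

definition forcing :: "real \<Rightarrow> 'k" where
  "forcing s = truncate T p s * c0 - feedback s"

lemma forcing_measurable [measurable]: "forcing \<in> borel_measurable borel"
  unfolding forcing_def[abs_def] by measurable

lemma norm_forcing: "norm (forcing s) \<le> (M * norm c0) * rl_kernel 1 s + (weight * M) * rl_kernel (a + 1) s"
proof -
  have "norm (truncate T p s * c0) \<le> (M * rl_kernel 1 s) * norm c0"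
    unfolding norm_mult by (intro mult_right_mono norm_truncate_source) simp
  then show ?thesis unfolding forcing_def
    using norm_feedback[of s] norm_triangle_ineq4[of "truncate T p s * c0" "feedback s"]
    by (simp add: mult_ac)
qed

text \<open>
  The evolution equation in integrated form: \<open>mode_eq\<close> multiplied by \<open>c n\<close> and summed, where
  \<open>\<Sum>n. lam n * norm (c n) < \<infinity>\<close> permits the exchange of sum and integral.
\<close>

lemma observation_sums:
  "(\<lambda>n. mode (lam n) t * c n) sums conv (rl_kernel a) forcing t"
proof -
  let ?q = "truncate T p"
  let ?f = "\<lambda>n s. rl_kernel a (t - s) *\<^sub>R (lam n *\<^sub>R (mode (lam n) s * c n))"
  have ib: "integrable lborel (\<lambda>s. rl_kernel a (t - s) *\<^sub>R w s)"
    if "w \<in> borel_measurable borel" "\<And>s. norm (w s) \<le> B * rl_kernel 1 s + C * rl_kernel (a + 1) s"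
    for w :: "real \<Rightarrow> 'k" and B C
    by (rule conv_integrable_bound[where a=a and b=1 and c="a + 1"])
       (use that a in \<open>auto simp: rl_kernel_nonneg\<close>)
  have int: "integrable lborel (?f n)" for n
    by (rule ib[where B=0 and C="lam n * norm (c n) * M"])
       (use feedback_term_bound[of n] in \<open>auto simp: mult.assoc\<close>)
  have a1: "0 < a + 1" using a by simp
  let ?G = "\<lambda>s. rl_kernel a (t - s) * rl_kernel (a + 1) s"
  have fb: "norm (?f n s) \<le> lam n * norm (c n) * (M * ?G s)" for n s
  proof -
    have "norm (?f n s) = rl_kernel a (t - s) * norm (lam n *\<^sub>R (mode (lam n) s * c n))"
      using rl_kernel_nonneg[OF a(1)] by (simp add: abs_mult)
    also have "\<dots> \<le> rl_kernel a (t - s) * (lam n * norm (c n) * (M * rl_kernel (a + 1) s))"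
      by (intro mult_left_mono feedback_term_bound rl_kernel_nonneg a)
    finally show ?thesis by (simp add: mult_ac)
  qed
  have sm1: "AE s in lborel. summable (\<lambda>n. norm (?f n s))"
  proof (rule AE_I2, rule summable_comparison_test')
    fix s
    show "summable (\<lambda>n. lam n * norm (c n) * (M * ?G s))" by (rule summable_mult2[OF sm])
    show "norm (norm (?f n s)) \<le> lam n * norm (c n) * (M * ?G s)" for n using fb[where n=n and s=s] by simp
  qed
  have sm2: "summable (\<lambda>n. \<integral> s. norm (?f n s) \<partial>lborel)"
  proof (rule summable_comparison_test')
    show "summable (\<lambda>n. lam n * norm (c n) * (M * (\<integral> s. ?G s \<partial>lborel)))" by (rule summable_mult2[OF sm])
    show "norm (\<integral> s. norm (?f n s) \<partial>lborel) \<le> lam n * norm (c n) * (M * (\<integral> s. ?G s \<partial>lborel))" for n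
    proof -
      have "(\<integral> s. norm (?f n s) \<partial>lborel) \<le> (\<integral> s. lam n * norm (c n) * (M * ?G s) \<partial>lborel)"
        by (intro integral_mono fb integrable_norm int integrable_mult_right integrable_rl_kernel_conv a a1)
      then show ?thesis by simp
    qed
  qed
  have "(\<lambda>n. \<integral> s. ?f n s \<partial>lborel) sums (\<integral> s. (\<Sum>n. ?f n s) \<partial>lborel)"
    by (rule sums_integral[OF int sm1 sm2])
  moreover have "(\<integral> s. ?f n s \<partial>lborel) = (lam n *\<^sub>R conv (rl_kernel a) (mode (lam n)) t) * c n" for n
  proof -
    have i: "integrable lborel (\<lambda>s. rl_kernel a (t - s) *\<^sub>R mode (lam n) s)"
      by (rule ib[where B=0 and C=M]) (use norm_mode[OF lam] in auto)
    have "(\<integral> s. (rl_kernel a (t - s) *\<^sub>R mode (lam n) s) * (lam n *\<^sub>R c n) \<partial>lborel)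
        = conv (rl_kernel a) (mode (lam n)) t * (lam n *\<^sub>R c n)"
      unfolding conv_def by (rule Bochner_Integration.integral_mult_left[OF i])
    then show ?thesis by (simp add: mult_ac)
  qed
  moreover have "(\<Sum>n. ?f n s) = rl_kernel a (t - s) *\<^sub>R feedback s" for s
    unfolding feedback_def by (rule suminf_scaleR_right[symmetric, OF summable_norm_cancel[OF summable_feedback]])
  ultimately have "(\<lambda>n. (lam n *\<^sub>R conv (rl_kernel a) (mode (lam n)) t) * c n) sums conv (rl_kernel a) feedback t"
    by (simp add: conv_def)
  moreover have "(\<lambda>n. conv (rl_kernel a) ?q t * c n) sums (conv (rl_kernel a) ?q t * c0)"
    by (rule sums_mult[OF c0])
  ultimately have "(\<lambda>n. conv (rl_kernel a) ?q t * c n - (lam n *\<^sub>R conv (rl_kernel a) (mode (lam n)) t) * c n)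
      sums (conv (rl_kernel a) ?q t * c0 - conv (rl_kernel a) feedback t)"
    by (intro sums_diff)
  moreover have "conv (rl_kernel a) ?q t * c n - (lam n *\<^sub>R conv (rl_kernel a) (mode (lam n)) t) * c n
      = mode (lam n) t * c n" for n
    by (simp only: mode_eq[OF lam, of n t] left_diff_distrib)
  moreover have "conv (rl_kernel a) ?q t * c0 - conv (rl_kernel a) feedback t = conv (rl_kernel a) forcing t"
  proof -
    have iq: "integrable lborel (\<lambda>s. rl_kernel a (t - s) *\<^sub>R ?q s)"
      by (rule ib[where B=M and C=0]) (use norm_truncate_source in auto)
    have "conv (rl_kernel a) ?q t * c0 = (\<integral> s. rl_kernel a (t - s) *\<^sub>R (?q s * c0) \<partial>lborel)"
      using Bochner_Integration.integral_mult_left[of c0, OF iq] by (simp add: conv_def)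
    moreover have "integrable lborel (\<lambda>s. rl_kernel a (t - s) *\<^sub>R (?q s * c0))"
      using integrable_mult_left[of c0, OF iq] by simp
    moreover have "integrable lborel (\<lambda>s. rl_kernel a (t - s) *\<^sub>R feedback s)"
      by (rule ib[where B=0 and C="weight * M"]) (use norm_feedback in auto)
    ultimately show ?thesis
      unfolding conv_def forcing_def by (simp add: scaleR_diff_right)
  qed
  ultimately show ?thesis by simp
qed

lemma conv_rl_forcing_semigroup:
  assumes b: "0 < b" and d: "0 < d"
  shows "conv (rl_kernel b) (conv (rl_kernel d) forcing) t = conv (rl_kernel (b + d)) forcing t"
proof (rule conv_assoc)
  show "integrable lborel (\<lambda>r. rl_kernel (b + d) (t - r) *\<^sub>R forcing r)"
    by (rule conv_integrable_bound[where a="b + d" and b=1 and c="a + 1"])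
       (use norm_forcing a b d in \<open>auto simp: rl_kernel_nonneg\<close>)
qed (use nn_integral_rl_kernel_conv[OF b d] b d in \<open>auto simp: rl_kernel_nonneg\<close>)

lemma norm_conv_forcing:
  assumes b: "0 < b"
  shows "norm (conv (rl_kernel b) forcing t) \<le> (M * norm c0) * rl_kernel (b + 1) t + (weight * M) * rl_kernel (b + (a + 1)) t"
  by (rule conv_norm_bound) (use norm_forcing a b in \<open>auto simp: rl_kernel_nonneg\<close>)

text \<open>
  For \<open>b = a - \<gamma>\<close> the left-hand side compares the fractional derivative of order \<open>\<gamma>\<close> of the
  observation with its leading term at \<open>t = 0\<close>, which comes from freezing the source at its initial value.
\<close>

lemma conv_forcing_expansion:
  assumes b: "0 < b" and t: "t \<le> T" and lip: "\<And>s. s \<in> {0..T} \<Longrightarrow> norm (p s - p0) \<le> M * s"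
  shows "norm (conv (rl_kernel b) forcing t - rl_kernel (b + 1) t *\<^sub>R (p0 * c0))
    \<le> (M * norm c0) * rl_kernel (b + 2) t + (weight * M) * rl_kernel (b + (a + 1)) t"
proof -
  let ?w = "\<lambda>s. forcing s - rl_kernel 1 s *\<^sub>R (p0 * c0)"
  have i1: "integrable lborel (\<lambda>s. rl_kernel b (t - s) *\<^sub>R forcing s)"
    by (rule conv_integrable_bound[where a=b and b=1 and c="a + 1"])
       (use norm_forcing a b in \<open>auto simp: rl_kernel_nonneg\<close>)
  have i2: "integrable lborel (\<lambda>s. rl_kernel b (t - s) * rl_kernel 1 s)"
    by (rule integrable_rl_kernel_conv) (use b in auto)
  have i3: "integrable lborel (\<lambda>s. rl_kernel b (t - s) *\<^sub>R rl_kernel 1 s *\<^sub>R (p0 * c0))"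
    using integrable_scaleR_left[OF i2, of "p0 * c0"] by simp
  have "(\<integral> s. rl_kernel b (t - s) *\<^sub>R rl_kernel 1 s *\<^sub>R (p0 * c0) \<partial>lborel) = rl_kernel (b + 1) t *\<^sub>R (p0 * c0)"
    using integral_scaleR_left[of "p0 * c0" lborel, OF i2] rl_kernel_conv[OF b zero_less_one, of t] by simp
  then have eq: "conv (rl_kernel b) ?w t = conv (rl_kernel b) forcing t - rl_kernel (b + 1) t *\<^sub>R (p0 * c0)"
    unfolding conv_def scaleR_diff_right using i1 i3 by simp
  have "norm (?w s) \<le> (M * norm c0) * rl_kernel 2 s + (weight * M) * rl_kernel (a + 1) s" if s: "s < t" for s
  proof (cases "0 < s")
    case True
    have "?w s = (p s - p0) * c0 - feedback s"
      using True s t by (simp add: forcing_def truncate_def rl_kernel_1 algebra_simps)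
    moreover have "norm ((p s - p0) * c0) \<le> (M * s) * norm c0"
      unfolding norm_mult by (intro mult_right_mono lip) (use True s t in auto)
    moreover have "rl_kernel 2 s = s" using True Gamma_fact[of 1, where 'a=real] by (simp add: rl_kernel_def)
    ultimately show ?thesis
      using norm_feedback[of s] norm_triangle_ineq4[of "(p s - p0) * c0" "feedback s"]
      by (simp add: mult_ac)
  next
    case False
    then show ?thesis using norm_forcing[of s] by simp
  qed
  then have "norm (conv (rl_kernel b) ?w t) \<le> (M * norm c0) * rl_kernel (b + 2) t + (weight * M) * rl_kernel (b + (a + 1)) t"
    by (intro conv_norm_bound) (use a b in \<open>auto simp: rl_kernel_nonneg\<close>)
  then show ?thesis by (simp only: eq)
qed

end

section \<open>The short-time expansion of the data\<close>

text \<open>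
  The bound \<open>B\<close> excludes an infinite essential supremum, whose conversion to a real number would
  be \<open>0\<close>.
\<close>

lemma AE_norm_le_Linf_norm:
  assumes m: "g \<in> borel_measurable (lebesgue_on {0<..<T})"
    and B: "AE t in lebesgue_on {0<..<T}. norm (g t) \<le> B"
  shows "AE t in lebesgue_on {0<..<T}. norm (g t) \<le> Linf_norm T g"
proof -
  let ?M = "lebesgue_on {0<..<T}"
  let ?e = "esssup ?M (\<lambda>t. ereal (norm (g t)))"
  have "?e \<le> ereal B"
    by (rule esssup_I) (use m B in auto)
  then have fin: "?e \<noteq> \<infinity>" by auto
  have "AE t in ?M. ereal (norm (g t)) \<le> ?e" by (rule esssup_AE)
  then show ?thesis
  proof eventually_elim
    case (elim t)
    with fin show ?case unfolding Linf_norm_def by (cases ?e) auto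
  qed
qed

context spectral_operator
begin

lemma solution_eq:
  assumes src: "scalar_source T a M p" and t: "0 < t" "t \<le> T"
  shows "solution scl lam P f p a t = (\<Sum>n. scl (scalar_source.mode T a p (lam n) t) (P n f))"
  unfolding solution_def
proof (intro arg_cong[where f=suminf] ext)
  interpret scalar_source T a M p by (rule src)
  fix n
  let ?k = "\<lambda>s. ml_kernel a (lam n) (t - s) *\<^sub>R truncate T p s"
  have eq: "indicator {0<..<t} s *\<^sub>R (((t - s) powr (a - 1) * mittag_leffler a a (- lam n * (t - s) powr a)) *\<^sub>R scl (p s) (P n f))
      = scl (?k s) (P n f)" for s
  proof (cases "0 < s \<and> s < t")
    case True
    then show ?thesis using t linear_cmul[OF bounded_linear.linear[OF bounded_linear_scl_left[of "P n f"]], of _ "p s"]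
      by (simp add: ml_kernel_def truncate_def)
  next
    case False
    then show ?thesis by (auto simp: truncate_def)
  qed
  have int: "integrable lborel ?k"
    by (rule conv_integrable_bound[where a=a and b=1 and c=1 and B=M and C=0])
       (use a norm_truncate_source ml_kernel_abs_le[OF lam_pos[of n]] in auto)
  have "(\<lambda>s. scl (?k s) (P n f)) \<in> borel_measurable borel"
    by (rule borel_measurable_continuous_on[OF linear_continuous_on[OF bounded_linear_scl_left]]) measurable
  then have "(\<integral> s. scl (?k s) (P n f) \<partial>lebesgue) = (\<integral> s. scl (?k s) (P n f) \<partial>lborel)"
    by (intro integral_completion) simp
  also have "\<dots> = scl (mode (lam n) t) (P n f)"
    unfolding mode_def conv_def by (rule integral_bounded_linear[OF bounded_linear_scl_left int])
  finally show "(LINT s:{0<..<t}|lebesgue. ((t - s) powr (a - 1) * mittag_leffler a a (- lam n * (t - s) powr a)) *\<^sub>R scl (p s) (P n f))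
      = scl (mode (lam n) t) (P n f)"
    unfolding set_lebesgue_integral_def eq .
qed

text \<open>
  The representative \<open>w\<close> of the fractional derivative is \<open>J\<^sup>a\<^sup>-\<^sup>g\<close> applied to \<open>forcing\<close>; by the
  semigroup law \<open>J\<^sup>g w\<close> is \<open>J\<^sup>a\<close> of the forcing, which is the observation.
\<close>

lemma frac_deriv_observation:
  fixes f \<psi> :: 'x and p0 :: 'k
  assumes src: "scalar_source T a M p" and lip: "\<And>s. s \<in> {0..T} \<Longrightarrow> norm (p s - p0) \<le> M * s"
    and \<psi>: "\<psi> \<in> D" and g: "0 \<le> g" "g < a"
  defines "h \<equiv> observation scl ip lam P f \<psi> p a"
  shows "\<exists>w B. L2_fun T (frac_deriv T g h)
    \<and> (AE t in lebesgue_on {0<..<T}. frac_deriv T g h t = w t)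
    \<and> (\<forall>t\<in>{0<..<T}. norm (w t) \<le> B)
    \<and> (\<forall>t\<le>T. norm (w t - rl_kernel (a - g + 1) t *\<^sub>R (p0 * ip f \<psi>))
       \<le> (M * norm (ip f \<psi>)) * rl_kernel (a - g + 2) t
         + ((\<Sum>n. lam n * norm (ip (P n f) \<psi>)) * M) * rl_kernel (2 * a - g + 1) t)"
proof -
  interpret scalar_source T a M p by (rule src)
  interpret o: scalar_observation T a M p lam "\<lambda>n. ip (P n f) \<psi>" "ip f \<psi>"
    by unfold_locales (use lam_pos summable_lam_ip[OF \<psi>] ip_P_sums in auto)
  define w where "w = conv (rl_kernel (a - g)) o.forcing"
  have ag: "0 < a - g" using g by simp
  have h_eq: "h t = conv (rl_kernel a) o.forcing t" if t: "0 < t" "t < T" for t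
  proof -
    have "norm (mode (lam n) t) \<le> M * rl_kernel (a + 1) t" for n by (rule norm_mode[OF lam_pos])
    from ip_suminf_scl_P[OF this] have "(\<lambda>n. mode (lam n) t * ip (P n f) \<psi>) sums h t"
      using t by (simp add: h_def observation_def solution_eq[OF src])
    then show ?thesis by (rule sums_unique2[OF _ o.observation_sums])
  qed
  have wm [measurable]: "w \<in> borel_measurable borel" unfolding w_def by measurable
  have w_neg: "w s = 0" if "s \<le> 0" for s
    using o.norm_conv_forcing[OF ag, of s] that by (simp add: w_def)
  have rep: "rl_integral g w t = h t" if t: "0 < t" "t < T" for t
  proof (cases "g = 0")
    case True
    then show ?thesis using h_eq[OF t] by (simp add: rl_integral_def w_def)
  next
    case False
    have "rl_integral g w t = conv (rl_kernel g) w t"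
      by (rule rl_integral_conv[OF False wm _ w_neg]) auto
    also have "\<dots> = conv (rl_kernel a) o.forcing t"
      unfolding w_def using o.conv_rl_forcing_semigroup[of g "a - g" t] False g by simp
    finally show ?thesis using h_eq[OF t] by simp
  qed
  define B where "B = (M * norm (ip f \<psi>)) * (T powr (a - g) / Gamma (a - g + 1))
      + (o.weight * M) * (T powr (a - g + a) / Gamma (a - g + (a + 1)))"
  have wB: "norm (w t) \<le> B" if t: "0 < t" "t < T" for t
  proof -
    have G: "0 < Gamma (a - g + 1)" "0 < Gamma (a - g + (a + 1))"
      using a g by (auto intro!: Gamma_real_pos)
    have "rl_kernel (a - g + 1) t \<le> T powr (a - g) / Gamma (a - g + 1)"
      using t ag G by (auto simp: rl_kernel_def intro!: divide_right_mono powr_mono2)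
    moreover have "rl_kernel (a - g + (a + 1)) t \<le> T powr (a - g + a) / Gamma (a - g + (a + 1))"
      using t ag a G by (auto simp: rl_kernel_def algebra_simps intro!: divide_right_mono powr_mono2)
    ultimately have "(M * norm (ip f \<psi>)) * rl_kernel (a - g + 1) t + (o.weight * M) * rl_kernel (a - g + (a + 1)) t \<le> B"
      unfolding B_def by (intro add_mono mult_left_mono mult_nonneg_nonneg o.weight_nonneg M) auto
    then show ?thesis using o.norm_conv_forcing[OF ag, of t] by (simp add: w_def)
  qed
  have sp: "space (lebesgue_on {0<..<T}) = {0<..<T}" by simp
  have wm': "w \<in> borel_measurable (lebesgue_on {0<..<T})"
  proof (rule measurable_restrict_space1)
    show "w \<in> borel_measurable lebesgue" by (rule measurable_completion) (simp add: wm)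
  qed
  have L2w: "L2_fun T w"
    unfolding L2_fun_def
  proof
    show "integrable (lebesgue_on {0<..<T}) (\<lambda>t. (norm (w t))\<^sup>2)"
    proof (rule Bochner_Integration.integrable_bound)
      show "integrable (lebesgue_on {0<..<T}) (\<lambda>t. B\<^sup>2)"
        by (rule finite_measure.integrable_const)
          (use T in \<open>auto intro!: finite_measureI simp: emeasure_restrict_space emeasure_lborel_Ioo\<close>)
      show "AE t in lebesgue_on {0<..<T}. norm ((norm (w t))\<^sup>2) \<le> norm (B\<^sup>2)"
        by (rule AE_I2) (auto intro!: power_mono wB)
    qed (use wm' in measurable)
  qed (rule wm')
  have fd: "L2_fun T (frac_deriv T g h)" "AE t in lebesgue_on {0<..<T}. frac_deriv T g h t = w t"
  proof -
    have "AE t in lebesgue_on {0<..<T}. rl_integral g w t = h t" by (rule AE_I2) (simp add: rep)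
    moreover have "g < 1" using g a by simp
    ultimately show "L2_fun T (frac_deriv T g h)" "AE t in lebesgue_on {0<..<T}. frac_deriv T g h t = w t"
      using frac_deriv_eqI[OF T g(1)] L2w by blast+
  qed
  have ex: "norm (w t - rl_kernel (a - g + 1) t *\<^sub>R (p0 * ip f \<psi>))
       \<le> (M * norm (ip f \<psi>)) * rl_kernel (a - g + 2) t
         + ((\<Sum>n. lam n * norm (ip (P n f) \<psi>)) * M) * rl_kernel (2 * a - g + 1) t" if "t \<le> T" for t
    using o.conv_forcing_expansion[OF ag that lip] by (simp add: w_def o.weight_def algebra_simps)
  show ?thesis
    by (intro exI[of _ w] exI[of _ B] conjI fd) (use wB ex in auto)
qed

text \<open>
  Both sources start from the same value, so the leading terms of the two data have the same
  coefficient and differ by their orders alone.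
\<close>

lemma data_distance_lower_bound:
  fixes f \<psi> :: 'x and p0 :: 'k
  assumes T: "0 < T" and p: "p \<in> admissible_sources T p0 M" and q: "q \<in> admissible_sources T p0 M"
    and \<psi>: "\<psi> \<in> D" and a: "a < 1" and b: "b < 1" and g: "0 \<le> g" "g < a" "g < b"
  defines "E \<equiv> \<lambda>a t. (M * norm (ip f \<psi>)) * rl_kernel (a - g + 2) t
         + ((\<Sum>n. lam n * norm (ip (P n f) \<psi>)) * M) * rl_kernel (2 * a - g + 1) t"
  shows "AE t in lborel. 0 < t \<longrightarrow> t < T \<longrightarrow>
      norm (p0 * ip f \<psi>) * \<bar>rl_kernel (a - g + 1) t - rl_kernel (b - g + 1) t\<bar>
      \<le> data_distance T scl ip lam P f \<psi> g p a q b + E a t + E b t"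
proof -
  note pb = admissible_sources_bounds[OF T p] and qb = admissible_sources_bounds[OF T q]
  have sp: "scalar_source T a M p" using T pb a g by unfold_locales auto
  have sq: "scalar_source T b M q" using T qb b g by unfold_locales auto
  let ?c = "p0 * ip f \<psi>"
  obtain w B where w: "L2_fun T (frac_deriv T g (observation scl ip lam P f \<psi> p a))"
    "AE t in lebesgue_on {0<..<T}. frac_deriv T g (observation scl ip lam P f \<psi> p a) t = w t"
    "\<forall>t\<in>{0<..<T}. norm (w t) \<le> B"
    "\<forall>t\<le>T. norm (w t - rl_kernel (a - g + 1) t *\<^sub>R ?c) \<le> E a t"
    using frac_deriv_observation[OF sp pb(4) \<psi> g(1,2), of f] unfolding E_def by blast
  obtain v B' where v: "L2_fun T (frac_deriv T g (observation scl ip lam P f \<psi> q b))"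
    "AE t in lebesgue_on {0<..<T}. frac_deriv T g (observation scl ip lam P f \<psi> q b) t = v t"
    "\<forall>t\<in>{0<..<T}. norm (v t) \<le> B'"
    "\<forall>t\<le>T. norm (v t - rl_kernel (b - g + 1) t *\<^sub>R ?c) \<le> E b t"
    using frac_deriv_observation[OF sq qb(4) \<psi> g(1,3), of f] unfolding E_def by blast
  let ?d = "\<lambda>t. frac_deriv T g (observation scl ip lam P f \<psi> p a) t
                    - frac_deriv T g (observation scl ip lam P f \<psi> q b) t"
  have "AE t in lebesgue_on {0<..<T}. norm (?d t) \<le> Linf_norm T ?d"
  proof (rule AE_norm_le_Linf_norm[where B="B + B'"])
    show "?d \<in> borel_measurable (lebesgue_on {0<..<T})"
      using w(1) v(1) unfolding L2_fun_def by (intro borel_measurable_diff) auto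
    have "AE t in lebesgue_on {0<..<T}. t \<in> {0<..<T}" by (rule AE_I2) simp
    with w(2) v(2) show "AE t in lebesgue_on {0<..<T}. norm (?d t) \<le> B + B'"
    proof eventually_elim
      case (elim t)
      then show ?case using w(3) v(3) norm_triangle_ineq4[of "w t" "v t"] by fastforce
    qed
  qed
  with w(2) v(2) have "AE t in lebesgue_on {0<..<T}. norm (w t - v t) \<le> data_distance T scl ip lam P f \<psi> g p a q b"
    by eventually_elim (simp add: data_distance_def)
  then have "AE t in lborel. 0 < t \<longrightarrow> t < T \<longrightarrow> norm (w t - v t) \<le> data_distance T scl ip lam P f \<psi> g p a q b"
    by (simp add: AE_restrict_space_iff AE_completion_iff imp_conjL)
  then show ?thesis
  proof eventually_elim
    case (elim t)
    show ?case
    proof (intro impI)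
      assume t: "0 < t" "t < T"
      have "norm ?c * \<bar>rl_kernel (a - g + 1) t - rl_kernel (b - g + 1) t\<bar>
          = norm ((rl_kernel (a - g + 1) t - rl_kernel (b - g + 1) t) *\<^sub>R ?c)"
        by (simp add: mult.commute)
      also have "(rl_kernel (a - g + 1) t - rl_kernel (b - g + 1) t) *\<^sub>R ?c
          = (w t - v t) - (w t - rl_kernel (a - g + 1) t *\<^sub>R ?c) + (v t - rl_kernel (b - g + 1) t *\<^sub>R ?c)"
        by (simp add: scaleR_diff_left)
      also have "norm \<dots> \<le> norm (w t - v t) + norm (w t - rl_kernel (a - g + 1) t *\<^sub>R ?c)
          + norm (v t - rl_kernel (b - g + 1) t *\<^sub>R ?c)"
        by (rule order_trans[OF norm_triangle_ineq add_right_mono[OF norm_triangle_ineq4]])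
      also have "\<dots> \<le> data_distance T scl ip lam P f \<psi> g p a q b + E a t + E b t"
        using elim t w(4) v(4) by (smt (verit))
      finally show "norm ?c * \<bar>rl_kernel (a - g + 1) t - rl_kernel (b - g + 1) t\<bar>
          \<le> data_distance T scl ip lam P f \<psi> g p a q b + E a t + E b t" .
    qed
  qed
qed

end

section \<open>Separation of orders at small times\<close>

text \<open>
  The logarithmic derivative of \<open>Gamma\<close> is increasing and exceeds \<open>- 1\<close> at \<open>1\<close>.
\<close>

lemma Gamma_le_exp_Gamma:
  fixes x y :: real
  assumes "1 \<le> x" "x \<le> y"
  shows "Gamma x \<le> exp (y - x) * Gamma y"
proof (cases "x = y")
  case False
  then have xy: "x < y" using assms by simp
  have "\<exists>z. x < z \<and> z < y \<and> ln_Gamma y - ln_Gamma x = (y - x) * Digamma z"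
    by (rule MVT2[OF xy]) (use assms in \<open>auto intro!: has_field_derivative_ln_Gamma_real\<close>)
  then obtain z where z: "x < z" "z < y" "ln_Gamma y - ln_Gamma x = (y - x) * Digamma z" by blast
  have "- 1 \<le> Digamma (1::real)" using euler_mascheroni_less_13_over_22 by simp
  also have "\<dots> \<le> Digamma z" by (rule Digamma_real_mono) (use z assms in auto)
  finally have "(y - x) * (- 1) \<le> (y - x) * Digamma z" using xy by (intro mult_left_mono) auto
  then have "ln_Gamma x \<le> (y - x) + ln_Gamma y" using z by simp
  then have "exp (ln_Gamma x) \<le> exp ((y - x) + ln_Gamma y)" by simp
  then show ?thesis using assms xy by (simp add: Gamma_real_pos_exp exp_add)
qed simp

lemma rl_kernel_upper:
  assumes "1 \<le> x" "0 < t"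
  shows "rl_kernel x t \<le> exp 2 * t powr (x - 1)"
proof -
  have "exp (- 2) \<le> Gamma x" using Gamma_lower_bound[OF assms(1), of 1] by simp
  then have "t powr (x - 1) / Gamma x \<le> t powr (x - 1) / exp (- 2)"
    using assms by (intro divide_left_mono) (auto intro!: mult_pos_pos Gamma_real_pos)
  also have "\<dots> = exp 2 * t powr (x - 1)"
    by (simp only: exp_minus divide_inverse inverse_inverse_eq mult.commute)
  finally show ?thesis using assms by (simp add: rl_kernel_def)
qed

lemma min_le_one_minus_exp:
  fixes z :: real
  assumes z: "0 \<le> z"
  shows "min z 1 / 2 \<le> 1 - exp (- z)"
proof -
  have "exp (- z) \<le> inverse (1 + z)"
    unfolding exp_minus using exp_ge_add_one_self[of z] z by (intro le_imp_inverse_le) auto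
  moreover have "min z 1 / 2 \<le> 1 - inverse (1 + z)"
  proof -
    have "min z 1 * (1 + z) \<le> 2 * z"
    proof (cases "z \<le> 1")
      case True
      have "z * (1 + z) \<le> z * 2" using True z by (intro mult_left_mono) auto
      then show ?thesis using True by simp
    qed simp
    then show ?thesis using z by (simp add: field_simps)
  qed
  ultimately show ?thesis by linarith
qed

text \<open>
  Factoring out \<open>t powr (x - 1) / Gamma x\<close> leaves
  \<open>1 - t powr (y - x) * Gamma x / Gamma y \<ge> 1 - exp (- (y - x) (\<bar>ln t\<bar> - 1))\<close>, and
  \<open>\<bar>ln t\<bar> - 1 \<ge> \<bar>ln t\<bar> / 2\<close> for \<open>t \<le> exp (- 2)\<close>. The gap never exceeds the larger
  kernel, of size \<open>t powr (x - 1)\<close>, so it can be linear in \<open>(y - x) \<bar>ln t\<bar>\<close> only up to a threshold: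
  hence the minimum with \<open>1\<close>.
\<close>

lemma rl_kernel_gap:
  assumes x: "1 \<le> x" "x \<le> y" "y \<le> 2" and t: "0 < t" "t \<le> exp (- 2)"
  shows "exp (- 1) / 2 * t powr (x - 1) * min ((y - x) * \<bar>ln t\<bar> / 2) 1 \<le> rl_kernel x t - rl_kernel y t"
proof -
  let ?d = "y - x" and ?z = "(y - x) * \<bar>ln t\<bar> / 2"
  have "ln t \<le> ln (exp (- 2))" using t by (subst ln_le_cancel_iff) auto
  then have lt: "ln t \<le> - 2" by simp
  have Gx: "0 < Gamma x" and Gy: "0 < Gamma y" using x by (auto intro!: Gamma_real_pos)
  have z: "0 \<le> ?z" using x by simp
  have "t powr ?d * Gamma x \<le> exp (?d * ln t) * (exp ?d * Gamma y)"
    using t Gamma_le_exp_Gamma[OF x(1,2)] by (intro mult_mono) (auto simp: powr_def less_imp_le[OF Gx])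
  also have "\<dots> = exp (?d * (ln t + 1)) * Gamma y"
    by (simp add: algebra_simps flip: exp_add)
  also have "\<dots> \<le> exp (- ?z) * Gamma y"
  proof -
    have "?d * (ln t + 1) \<le> ?d * (ln t / 2)" using lt x by (intro mult_left_mono) auto
    then have "?d * (ln t + 1) \<le> - ?z" using lt by (simp add: abs_if)
    then show ?thesis using Gy by simp
  qed
  finally have 1: "t powr ?d / Gamma y \<le> exp (- ?z) / Gamma x"
    using Gx Gy by (simp add: field_simps)
  have Gx1: "Gamma x \<le> exp 1"
  proof -
    have "Gamma x \<le> exp (2 - x) * Gamma 2" by (rule Gamma_le_exp_Gamma) (use x in auto)
    also have "Gamma (2::real) = 1" using Gamma_fact[of 1, where 'a=real] by simp
    also have "exp (2 - x) * 1 \<le> exp 1" using x by simp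
    finally show ?thesis .
  qed
  have 2: "min ?z 1 / 2 \<le> 1 - exp (- ?z)" by (rule min_le_one_minus_exp[OF z])
  have "exp (- 1) \<le> 1 / Gamma x"
    using Gx Gx1 by (simp add: exp_minus field_simps)
  then have "exp (- 1) * (min ?z 1 / 2) \<le> 1 / Gamma x * (1 - exp (- ?z))"
    using 2 z Gx by (intro mult_mono) auto
  also have "\<dots> \<le> 1 / Gamma x - t powr ?d / Gamma y"
    using 1 by (simp add: algebra_simps)
  finally have "t powr (x - 1) * (exp (- 1) * (min ?z 1 / 2)) \<le> t powr (x - 1) * (1 / Gamma x - t powr ?d / Gamma y)"
    by (intro mult_left_mono) auto
  also have "\<dots> = rl_kernel x t - rl_kernel y t"
    using t powr_add[of t "x - 1" ?d] by (simp add: rl_kernel_def algebra_simps)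
  finally show ?thesis by (simp add: mult_ac)
qed

text \<open>
  After division by \<open>t powr (a - g)\<close>, the left-hand side of the hypothesis is bounded below through
  \<open>(b - a) \<bar>ln t\<bar>\<close> and the right-hand side above by \<open>\<epsilon> t powr (g - a) + t powr a\<close>, up to constants;
  the last two terms are equal at \<open>t = \<epsilon> powr (1 / (2 a - g))\<close>. The three bounds on \<open>\<epsilon>\<close> ensure
  \<open>t \<le> exp (- 2)\<close>, as \<open>rl_kernel_gap\<close> requires, \<open>t \<le> T\<close>, and a right-hand side so small that
  the minimum in \<open>rl_kernel_gap\<close> cannot be \<open>1\<close>.
\<close>

lemma order_gap_bound:
  fixes am ap g c C T :: real
  assumes am: "0 < am" and ap: "ap < 1" and g: "0 \<le> g" "g < am" and c: "0 < c" and C: "0 \<le> C" and T: "0 < T"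
    and aap: "am \<le> ap"
  defines "\<theta> \<equiv> ap / (2 * ap - g)"
  obtains \<epsilon>0 K where "0 < \<epsilon>0" "0 < K"
    "\<And>a b \<epsilon>. am \<le> a \<Longrightarrow> a \<le> b \<Longrightarrow> b \<le> ap \<Longrightarrow> 0 < \<epsilon> \<Longrightarrow> \<epsilon> \<le> \<epsilon>0 \<Longrightarrow>
      AE t in lborel. 0 < t \<longrightarrow> t < T \<longrightarrow>
        c * \<bar>rl_kernel (a - g + 1) t - rl_kernel (b - g + 1) t\<bar>
        \<le> \<epsilon> + (C * rl_kernel (a - g + 2) t + C * rl_kernel (2 * a - g + 1) t)
          + (C * rl_kernel (b - g + 2) t + C * rl_kernel (2 * b - g + 1) t)
      \<Longrightarrow> b - a \<le> K * (\<epsilon> powr \<theta> / (1 + \<bar>ln \<epsilon>\<bar>))"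
proof -
  define c2 where "c2 = c * exp (- 1) / 2"
  have c2: "0 < c2" using c by (simp add: c2_def)
  define K1 where "K1 = 2 + 4 * (C * exp 2)"
  have K1: "0 < K1" using C by (simp add: K1_def add_pos_nonneg)
  have \<theta>: "0 < \<theta>" using am ap g aap by (simp add: \<theta>_def)
  define \<epsilon>0 where "\<epsilon>0 = Min {exp (- 4), T\<^sup>2, (c2 / (2 * K1)) powr (1 / \<theta>)}"
  have \<epsilon>0: "0 < \<epsilon>0" using T c2 K1 by (simp add: \<epsilon>0_def)
  define K where "K = 8 * K1 / c2"
  have K: "0 < K" using K1 c2 by (simp add: K_def)
  show thesis
  proof (rule that[OF \<epsilon>0 K])
    fix a b \<epsilon> :: real
    assume ab: "am \<le> a" "a \<le> b" "b \<le> ap" and \<epsilon>: "0 < \<epsilon>" "\<epsilon> \<le> \<epsilon>0"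
      and AE: "AE t in lborel. 0 < t \<longrightarrow> t < T \<longrightarrow>
        c * \<bar>rl_kernel (a - g + 1) t - rl_kernel (b - g + 1) t\<bar>
        \<le> \<epsilon> + (C * rl_kernel (a - g + 2) t + C * rl_kernel (2 * a - g + 1) t)
          + (C * rl_kernel (b - g + 2) t + C * rl_kernel (2 * b - g + 1) t)"
    have e: "\<epsilon> \<le> exp (- 4)" "\<epsilon> \<le> T\<^sup>2" "\<epsilon> \<le> (c2 / (2 * K1)) powr (1 / \<theta>)"
      using \<epsilon> by (auto simp: \<epsilon>0_def)
    have e1: "\<epsilon> \<le> 1" using e(1) by (rule order_trans) simp
    have a: "0 < a" "a < 1" "g < a" "0 < 2 * a - g" "2 * a - g < 2" using ab am ap g by auto
    define \<tau> where "\<tau> = \<epsilon> powr (1 / (2 * a - g))"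
    have \<tau>0: "0 < \<tau>" using \<epsilon> by (simp add: \<tau>_def)
    have "\<tau> \<le> \<epsilon> powr (1 / 2)"
      unfolding \<tau>_def by (rule powr_mono') (use a \<epsilon> e1 in \<open>auto simp: field_simps\<close>)
    also have "\<dots> = sqrt \<epsilon>" using \<epsilon> by (simp add: powr_half_sqrt)
    finally have \<tau>s: "\<tau> \<le> sqrt \<epsilon>" .
    have \<tau>T: "\<tau> \<le> T" using \<tau>s real_le_lsqrt[of T \<epsilon>] e(2) T \<epsilon> by simp
    have "sqrt \<epsilon> \<le> sqrt (exp (- 4))" using e(1) by simp
    also have "sqrt (exp (- 4)) = exp (- 2 :: real)"
      by (rule real_sqrt_unique) (simp_all flip: exp_of_nat_mult)
    finally have \<tau>e: "\<tau> \<le> exp (- 2)" using \<tau>s by simp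
    have e2: "exp (- 2 :: real) \<le> 1" by simp
    \<comment> \<open>The estimate for the data holds almost everywhere only, so \<open>\<tau>\<close> itself may be excluded; any
      point of \<open>(\<tau> / 2, \<tau>)\<close> serves equally well up to a factor.\<close>
    have "\<exists>t. \<tau> / 2 < t \<and> t < \<tau> \<and>
        c * \<bar>rl_kernel (a - g + 1) t - rl_kernel (b - g + 1) t\<bar>
        \<le> \<epsilon> + (C * rl_kernel (a - g + 2) t + C * rl_kernel (2 * a - g + 1) t)
          + (C * rl_kernel (b - g + 2) t + C * rl_kernel (2 * b - g + 1) t)"
    proof (rule ccontr)
      assume no: "\<not> ?thesis"
      have "AE t in lborel. \<not> (\<tau> / 2 < t \<and> t < \<tau>)"
        using AE by eventually_elim (use no \<tau>0 \<tau>T in auto)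
      then have "emeasure lborel {\<tau> / 2<..<\<tau>} = 0"
        by (subst (asm) AE_iff_measurable[OF _ refl]) (auto simp: greaterThanLessThan_def greaterThan_def lessThan_def Collect_conj_eq[symmetric])
      then show False using \<tau>0 by (simp add: emeasure_lborel_Ioo)
    qed
    then obtain t where t: "\<tau> / 2 < t" "t < \<tau>" and
      ineq: "c * \<bar>rl_kernel (a - g + 1) t - rl_kernel (b - g + 1) t\<bar>
        \<le> \<epsilon> + (C * rl_kernel (a - g + 2) t + C * rl_kernel (2 * a - g + 1) t)
          + (C * rl_kernel (b - g + 2) t + C * rl_kernel (2 * b - g + 1) t)" by blast
    have t0: "0 < t" and t1: "t \<le> exp (- 2)" "t \<le> 1" using t \<tau>0 \<tau>e e2 by linarith+
    let ?m = "min ((b - a) * \<bar>ln t\<bar> / 2) 1"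
    have up: "C * rl_kernel x t \<le> C * exp 2 * t powr (2 * a - g)" if "2 * a - g + 1 \<le> x" for x
    proof -
      have "rl_kernel x t \<le> exp 2 * t powr (x - 1)" by (rule rl_kernel_upper) (use that a t0 in auto)
      also have "\<dots> \<le> exp 2 * t powr (2 * a - g)"
        by (intro mult_left_mono powr_mono') (use that t0 t1 in auto)
      finally show ?thesis using mult_left_mono[OF _ C] by (simp add: mult.assoc)
    qed
    have "c * (exp (- 1) / 2 * t powr (a - g) * ?m) \<le> c * \<bar>rl_kernel (a - g + 1) t - rl_kernel (b - g + 1) t\<bar>"
    proof (rule mult_left_mono)
      have "exp (- 1) / 2 * t powr ((a - g + 1) - 1) * min (((b - g + 1) - (a - g + 1)) * \<bar>ln t\<bar> / 2) 1
          \<le> rl_kernel (a - g + 1) t - rl_kernel (b - g + 1) t"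
        by (rule rl_kernel_gap) (use a ab ap g t0 t1 in auto)
      moreover have "(a - g + 1) - 1 = a - g" "(b - g + 1) - (a - g + 1) = b - a" by auto
      ultimately have "exp (- 1) / 2 * t powr (a - g) * ?m \<le> rl_kernel (a - g + 1) t - rl_kernel (b - g + 1) t"
        by (simp only:)
      then show "exp (- 1) / 2 * t powr (a - g) * ?m \<le> \<bar>rl_kernel (a - g + 1) t - rl_kernel (b - g + 1) t\<bar>"
        by (rule order_trans[OF _ abs_ge_self])
    qed (use c in simp)
    also note ineq
    also have "\<epsilon> + (C * rl_kernel (a - g + 2) t + C * rl_kernel (2 * a - g + 1) t)
          + (C * rl_kernel (b - g + 2) t + C * rl_kernel (2 * b - g + 1) t)
        \<le> \<epsilon> + 4 * (C * exp 2) * t powr (2 * a - g)"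
      using up[of "a - g + 2"] up[of "2 * a - g + 1"] up[of "b - g + 2"] up[of "2 * b - g + 1"] ab a by simp
    finally have main: "c2 * t powr (a - g) * ?m \<le> \<epsilon> + 4 * (C * exp 2) * t powr (2 * a - g)"
      by (simp add: c2_def mult_ac)
    have split: "t powr (2 * a - g) = t powr (a - g) * t powr a"
      by (simp flip: powr_add)
    have inv: "t powr (a - g) * t powr (- (a - g)) = 1"
      using t0 by (subst powr_add[symmetric]) simp
    have "c2 * ?m = (c2 * ?m) * (t powr (a - g) * t powr (- (a - g)))"
      by (simp only: inv mult_1_right)
    also have "\<dots> = (c2 * t powr (a - g) * ?m) * t powr (- (a - g))"
      by (simp only: mult_ac)
    also have "\<dots> \<le> (\<epsilon> + 4 * (C * exp 2) * t powr (2 * a - g)) * t powr (- (a - g))"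
      by (rule mult_right_mono[OF main]) simp
    also have "\<dots> = \<epsilon> * t powr (- (a - g)) + 4 * (C * exp 2) * t powr a * (t powr (a - g) * t powr (- (a - g)))"
      by (subst split) (simp only: ring_distribs mult_ac)
    also have "\<dots> = \<epsilon> * t powr (- (a - g)) + 4 * (C * exp 2) * t powr a"
      by (simp only: inv mult_1_right)
    also have "\<dots> \<le> 2 * \<epsilon> powr (a / (2 * a - g)) + 4 * (C * exp 2) * \<epsilon> powr (a / (2 * a - g))"
    proof (intro add_mono mult_left_mono)
      have "t powr (- (a - g)) \<le> (\<tau> / 2) powr (- (a - g))"
        by (rule powr_mono2') (use a t \<tau>0 in auto)
      also have "\<dots> = 2 powr (a - g) * \<tau> powr (- (a - g))"
      proof -
        have "(\<tau> / 2) powr (- (a - g)) = \<tau> powr (- (a - g)) / 2 powr (- (a - g))"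
          by (rule powr_divide)
        also have "2 powr (- (a - g)) = 1 / (2 powr (a - g) :: real)" by (rule powr_minus_divide)
        finally show ?thesis by simp
      qed
      also have "\<dots> \<le> 2 * \<tau> powr (- (a - g))"
        using powr_mono[of "a - g" 1 "2::real"] a g by (intro mult_right_mono) auto
      finally have "\<epsilon> * t powr (- (a - g)) \<le> \<epsilon> * (2 * \<tau> powr (- (a - g)))"
        using \<epsilon> by simp
      also have "\<epsilon> * (2 * \<tau> powr (- (a - g))) = 2 * (\<epsilon> powr 1 * \<epsilon> powr (- (a - g) / (2 * a - g)))"
        using \<epsilon> by (simp add: \<tau>_def powr_powr)
      also have "\<dots> = 2 * \<epsilon> powr (a / (2 * a - g))"
      proof -
        have "1 + - (a - g) / (2 * a - g) = a / (2 * a - g)" using a by (simp add: field_simps)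
        then show ?thesis by (simp only: powr_add[symmetric])
      qed
      finally show "\<epsilon> * t powr (- (a - g)) \<le> 2 * \<epsilon> powr (a / (2 * a - g))" .
      have "t powr a \<le> \<tau> powr a" by (rule powr_mono2) (use a t t0 in auto)
      then show "t powr a \<le> \<epsilon> powr (a / (2 * a - g))" by (simp add: \<tau>_def powr_powr)
    qed (use C in auto)
    also have "\<dots> = K1 * \<epsilon> powr (a / (2 * a - g))" by (simp add: K1_def algebra_simps)
    also have "\<dots> \<le> K1 * \<epsilon> powr \<theta>"
    proof (intro mult_left_mono powr_mono')
      \<comment> \<open>The exponent \<open>a / (2 a - g)\<close> decreases in \<open>a\<close>, so \<open>a = ap\<close> is the worst case.\<close>
      have "ap * (2 * a - g) \<le> a * (2 * ap - g)"
        using mult_right_mono[of a ap g] ab g by (simp add: algebra_simps)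
      then show "\<theta> \<le> a / (2 * a - g)"
        unfolding \<theta>_def using a ab by (simp add: frac_le_eq divide_le_0_iff field_simps)
    qed (use \<epsilon> e1 K1 in auto)
    finally have fin: "c2 * ?m \<le> K1 * \<epsilon> powr \<theta>" .
    have "\<epsilon> powr \<theta> \<le> c2 / (2 * K1)"
      using powr_mono2[of \<theta> \<epsilon> "(c2 / (2 * K1)) powr (1 / \<theta>)"] e(3) \<epsilon> \<theta> c2 K1 by (simp add: powr_powr)
    then have "K1 * \<epsilon> powr \<theta> \<le> c2 / 2" using K1 by (simp add: field_simps)
    then have "c2 * ?m \<le> c2 / 2" using fin by linarith
    then have "?m < 1" using c2 by simp
    then have m: "?m = (b - a) * \<bar>ln t\<bar> / 2" by linarith
    have ln: "(1 + \<bar>ln \<epsilon>\<bar>) / 4 \<le> \<bar>ln t\<bar>"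
    proof -
      have "ln \<epsilon> \<le> ln (exp (- 4))" using e(1) \<epsilon> by (subst ln_le_cancel_iff) auto
      then have l4: "ln \<epsilon> \<le> - 4" by simp
      have "ln t \<le> ln (sqrt \<epsilon>)" using t t0 \<tau>s \<epsilon> by (subst ln_le_cancel_iff) auto
      also have "\<dots> = ln \<epsilon> / 2" using \<epsilon> by (simp add: ln_sqrt)
      finally have "ln t \<le> ln \<epsilon> / 2" .
      moreover have "\<bar>ln \<epsilon>\<bar> = - ln \<epsilon>" using l4 by simp
      ultimately show ?thesis using l4 abs_ge_minus_self[of "ln t"] by simp
    qed
    have "(b - a) * ((1 + \<bar>ln \<epsilon>\<bar>) / 4) * c2 / 2 \<le> (b - a) * \<bar>ln t\<bar> * c2 / 2"
      using ln ab c2 by (intro divide_right_mono mult_right_mono mult_left_mono) auto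
    also have "\<dots> = c2 * ?m" by (subst m) simp
    also note fin
    finally have "(b - a) * (1 + \<bar>ln \<epsilon>\<bar>) \<le> K * \<epsilon> powr \<theta>"
      using c2 by (simp add: K_def field_simps)
    then show "b - a \<le> K * (\<epsilon> powr \<theta> / (1 + \<bar>ln \<epsilon>\<bar>))"
      by (simp add: pos_le_divide_eq add_pos_nonneg)
  qed
qed

section \<open>Stability of the order\<close>

theorem theorem4p2:
  fixes scl :: "'k::{real_normed_field,euclidean_space} \<Rightarrow>
      'x::{real_inner,banach,second_countable_topology} \<Rightarrow> 'x"
    and ip :: "'x \<Rightarrow> 'x \<Rightarrow> 'k"
    and D :: "'x set" and A :: "'x \<Rightarrow> 'x" and lam :: "nat \<Rightarrow> real" and P :: "nat \<Rightarrow> 'x \<Rightarrow> 'x"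
    and T \<alpha>\<^sub>m \<alpha>\<^sub>p M \<gamma> :: real and p\<^sub>0 :: 'k and f \<psi> :: 'x
  assumes "T > 0"
    and "spectral_operator scl ip D A lam P"
    and "0 < \<alpha>\<^sub>m" "\<alpha>\<^sub>m < \<alpha>\<^sub>p" "\<alpha>\<^sub>p < 1"
    and "p\<^sub>0 \<noteq> 0" "M > norm p\<^sub>0"
    and "\<psi> \<in> D" "p\<^sub>0 * ip f \<psi> \<noteq> 0"
    and "0 \<le> \<gamma>" "\<gamma> < \<alpha>\<^sub>m"
  shows "let \<theta> = \<alpha>\<^sub>p / (2 * \<alpha>\<^sub>p - \<gamma>) in
    \<theta> \<in> {1/2..<1} \<and>
    (\<exists>D\<^sub>0>0. \<exists>C>0.
       \<forall>p\<in>admissible_sources T p\<^sub>0 M. \<forall>q\<in>admissible_sources T p\<^sub>0 M.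
       \<forall>\<alpha>\<in>{\<alpha>\<^sub>m..\<alpha>\<^sub>p}. \<forall>\<beta>\<in>{\<alpha>\<^sub>m..\<alpha>\<^sub>p}.
         let D\<^sub>\<gamma> = data_distance T scl ip lam P f \<psi> \<gamma> p \<alpha> q \<beta> in
           (0 < D\<^sub>\<gamma> \<and> D\<^sub>\<gamma> \<le> D\<^sub>0 \<longrightarrow>
              \<bar>\<alpha> - \<beta>\<bar> \<le> C * (D\<^sub>\<gamma> powr \<theta> / (1 + \<bar>ln D\<^sub>\<gamma>\<bar>))) \<and>
           (D\<^sub>\<gamma> = 0 \<longrightarrow> \<alpha> = \<beta>))"
proof -
  interpret spectral_operator scl ip D A lam P by fact
  define S where "S = (\<Sum>n. lam n * norm (ip (P n f) \<psi>))"
  have S: "0 \<le> S"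
    unfolding S_def
    by (intro suminf_nonneg summable_lam_ip \<open>\<psi> \<in> D\<close>) (simp add: less_imp_le[OF lam_pos])
  have M: "0 \<le> M" using assms(7) norm_ge_zero[of p\<^sub>0] by linarith
  define C where "C = M * norm (ip f \<psi>) + S * M"
  have C: "0 \<le> C" "M * norm (ip f \<psi>) \<le> C" "S * M \<le> C"
    using S M by (auto simp: C_def)
  have c: "0 < norm (p\<^sub>0 * ip f \<psi>)" using assms(9) by simp
  define \<theta> where "\<theta> = \<alpha>\<^sub>p / (2 * \<alpha>\<^sub>p - \<gamma>)"
  have \<theta>: "\<theta> \<in> {1/2..<1}" "0 < \<theta>"
    using assms by (auto simp: \<theta>_def field_simps)
  obtain \<epsilon>0 K where \<epsilon>0: "0 < \<epsilon>0" and K: "0 < K" and bd: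
    "\<And>a b \<epsilon>. \<alpha>\<^sub>m \<le> a \<Longrightarrow> a \<le> b \<Longrightarrow> b \<le> \<alpha>\<^sub>p \<Longrightarrow> 0 < \<epsilon> \<Longrightarrow> \<epsilon> \<le> \<epsilon>0 \<Longrightarrow>
      AE t in lborel. 0 < t \<longrightarrow> t < T \<longrightarrow>
        norm (p\<^sub>0 * ip f \<psi>) * \<bar>rl_kernel (a - \<gamma> + 1) t - rl_kernel (b - \<gamma> + 1) t\<bar>
        \<le> \<epsilon> + (C * rl_kernel (a - \<gamma> + 2) t + C * rl_kernel (2 * a - \<gamma> + 1) t)
          + (C * rl_kernel (b - \<gamma> + 2) t + C * rl_kernel (2 * b - \<gamma> + 1) t)
      \<Longrightarrow> b - a \<le> K * (\<epsilon> powr \<theta> / (1 + \<bar>ln \<epsilon>\<bar>))"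
    unfolding \<theta>_def
    by (rule order_gap_bound[of \<alpha>\<^sub>m \<alpha>\<^sub>p \<gamma> "norm (p\<^sub>0 * ip f \<psi>)" C T]) (use assms C c in auto)
  have gap: "\<bar>a - b\<bar> \<le> K * (\<epsilon> powr \<theta> / (1 + \<bar>ln \<epsilon>\<bar>))"
    if p: "p \<in> admissible_sources T p\<^sub>0 M" and q: "q \<in> admissible_sources T p\<^sub>0 M"
      and a: "a \<in> {\<alpha>\<^sub>m..\<alpha>\<^sub>p}" and b: "b \<in> {\<alpha>\<^sub>m..\<alpha>\<^sub>p}" and \<epsilon>: "0 < \<epsilon>" "\<epsilon> \<le> \<epsilon>0"
      and D: "data_distance T scl ip lam P f \<psi> \<gamma> p a q b \<le> \<epsilon>" for p q a b \<epsilon>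
  proof -
    let ?E = "\<lambda>a t. C * rl_kernel (a - \<gamma> + 2) t + C * rl_kernel (2 * a - \<gamma> + 1) t"
    have E: "(M * norm (ip f \<psi>)) * rl_kernel (a - \<gamma> + 2) t + (S * M) * rl_kernel (2 * a - \<gamma> + 1) t \<le> ?E a t"
      if "\<alpha>\<^sub>m \<le> a" for a t
      by (intro add_mono mult_right_mono C rl_kernel_nonneg) (use that assms in auto)
    have ae: "AE t in lborel. 0 < t \<longrightarrow> t < T \<longrightarrow>
      norm (p\<^sub>0 * ip f \<psi>) * \<bar>rl_kernel (a - \<gamma> + 1) t - rl_kernel (b - \<gamma> + 1) t\<bar> \<le> \<epsilon> + ?E a t + ?E b t"
    proof -
      have "a < 1" "b < 1" "\<gamma> < a" "\<gamma> < b" using a b assms by auto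
      from data_distance_lower_bound[OF assms(1) p q assms(8) this(1,2) assms(10) this(3,4), of f]
      show ?thesis
      proof eventually_elim
        case (elim t)
        have "\<alpha>\<^sub>m \<le> a" "\<alpha>\<^sub>m \<le> b" using a b by auto
        from E[OF this(1), of t] E[OF this(2), of t] elim D show ?case
          unfolding S_def by linarith
      qed
    qed
    show ?thesis
    proof (cases "a \<le> b")
      case True
      then show ?thesis using bd[OF _ True _ \<epsilon> ae] a b by auto
    next
      case False
      have "AE t in lborel. 0 < t \<longrightarrow> t < T \<longrightarrow>
        norm (p\<^sub>0 * ip f \<psi>) * \<bar>rl_kernel (b - \<gamma> + 1) t - rl_kernel (a - \<gamma> + 1) t\<bar> \<le> \<epsilon> + ?E b t + ?E a t"
        using ae by eventually_elim (simp add: abs_minus_commute add_ac)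
      then show ?thesis using bd[OF _ _ _ \<epsilon>, of b a] False a b by auto
    qed
  qed
  have zero: "a = b"
    if p: "p \<in> admissible_sources T p\<^sub>0 M" and q: "q \<in> admissible_sources T p\<^sub>0 M"
      and a: "a \<in> {\<alpha>\<^sub>m..\<alpha>\<^sub>p}" and b: "b \<in> {\<alpha>\<^sub>m..\<alpha>\<^sub>p}"
      and D: "data_distance T scl ip lam P f \<psi> \<gamma> p a q b = 0" for p q a b
  proof -
    have "((\<lambda>\<epsilon>. K * \<epsilon> powr \<theta>) \<longlongrightarrow> K * 0 powr \<theta>) (at_right 0)"
      by (intro tendsto_intros tendsto_powr' ) (use \<theta> in \<open>auto intro: eventually_at_right_less simp: eventually_at_filter\<close>)
    moreover have "\<forall>\<^sub>F \<epsilon> in at_right 0. \<bar>a - b\<bar> \<le> K * \<epsilon> powr \<theta>"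
      using eventually_at_right_less[of 0] eventually_at_right_real[OF \<epsilon>0]
    proof eventually_elim
      case (elim \<epsilon>)
      then have "\<bar>a - b\<bar> \<le> K * (\<epsilon> powr \<theta> / (1 + \<bar>ln \<epsilon>\<bar>))"
        using gap[OF p q a b, of \<epsilon>] D by auto
      also have "\<dots> \<le> K * (\<epsilon> powr \<theta> / 1)"
        using K by (intro mult_left_mono divide_left_mono) auto
      finally show ?case by simp
    qed
    ultimately have "\<bar>a - b\<bar> \<le> K * 0 powr \<theta>"
      by (intro tendsto_lowerbound) auto
    then show ?thesis by simp
  qed
  show ?thesis
    unfolding Let_def \<theta>_def[symmetric]
    using \<theta>(1) \<epsilon>0 K gap zero by (intro conjI exI[of _ \<epsilon>0] exI[of _ K] ballI impI) auto
qed

end
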